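(* Let $\bm H$ be a finite-dimensional Hilbert space and $\rho_{\rm i}$ a density operator on $\bm H$. Let $1\le m<N$. Let $\mathcal E_1,\dots,\mathcal E_m:L(\bm H)\to L(\bm H)$ be completely positive trace-preserving (CPTP) maps, each $\mathcal E_n$ having a unique steady state $\rho_{{\rm ss},n}$ (density operator with $\mathcal E_n(\rho_{{\rm ss},n})=\rho_{{\rm ss},n}$), assumed positive definite. Set $\rho_0:=\rho_{\rm i}$, $\rho_n:=\mathcal E_n(\rho_{n-1})$ for $1\le n\le m$. Let $\{M_b\}_{b\in B}\subset L(\bm H)$, $B$ finite, with $\sum_b M_b^\dagger M_b=I$; put $p(b):=\mathrm{tr}[M_b^\dagger M_b\rho_m]$ and, for $p(b)>0$, $\rho_m^{(b)}:=M_b\rho_mM_b^\dagger/p(b)$, and $I_{\rm QC}:=S(\rho_m)-\sum_b p(b)S(\rho_m^{(b)})$. For each $b$ with $p(b)>0$ let $\mathcal E^{(b)}_{m+1},\dots,\mathcal E^{(b)}_N$ be CPTP maps on $L(\bm H)$, each $\mathcal E^{(b)}_n$ having a unique, positive definite steady state $\rho^{(b)}_{{\rm ss},n}$, and set $\rho_n^{(b)}:=\mathcal E_n^{(b)}(\rho_{n-1}^{(b)})$ for $m+1\le n\le N$. Define $$\sigma^B_{\rm ex}:=\sum_{n=1}^m\big(\mathrm{tr}[\rho_n\ln\rho_{{\rm ss},n}]-\mathrm{tr}[\rho_{n-1}\ln\rho_{{\rm ss},n}]\big)+\sum_b p(b)\sum_{n=m+1}^N\big(\mathrm{tr}[\rho^{(b)}_n\ln\rho^{(b)}_{{\rm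 ss},n}]-\mathrm{tr}[\rho^{(b)}_{n-1}\ln\rho^{(b)}_{{\rm ss},n}]\big).$$ Then (sums over $b$ with $p(b)>0$) $$\sum_b p(b)\,S(\rho_N^{(b)})-S(\rho_{\rm i})\ \ge\ -\sigma^B_{\rm ex}-I_{\rm QC}.$$
   Context: $L(\bm H)$ is the space of linear operators on $\bm H$. $S(\rho):=-\mathrm{tr}[\rho\ln\rho]$ is the von Neumann entropy (with $0\ln0=0$). *)

theory Defs
  imports "Jordan_Normal_Form.Matrix"
begin

text \<open>Finite-dimensional Hilbert space H = C^d; operators are complex d x d matrices.\<close>

definition mtrace :: "complex mat \<Rightarrow> complex" where
  "mtrace A = (\<Sum>i<dim_row A. A $$ (i, i))"

definition adj :: "complex mat \<Rightarrow> complex mat" where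
  "adj A = mat (dim_col A) (dim_row A) (\<lambda>(i, j). cnj (A $$ (j, i)))"

definition hermitian :: "complex mat \<Rightarrow> bool" where
  "hermitian A \<longleftrightarrow> A \<in> carrier_mat (dim_row A) (dim_row A) \<and> adj A = A"

definition psd :: "complex mat \<Rightarrow> bool" where
  "psd A \<longleftrightarrow> hermitian A \<and>
     (\<forall>v \<in> carrier_vec (dim_row A).
        (let q = (\<Sum>i<dim_row A. cnj (v $ i) * (A *\<^sub>v v) $ i) in Im q = 0 \<and> Re q \<ge> 0))"

definition pos_def :: "complex mat \<Rightarrow> bool" where
  "pos_def A \<longleftrightarrow> hermitian A \<and>
     (\<forall>v \<in> carrier_vec (dim_row A). v \<noteq> 0\<^sub>v (dim_row A) \<longrightarrow>
        (let q = (\<Sum>i<dim_row A. cnj (v $ i) * (A *\<^sub>v v) $ i) in Im q = 0 \<and> Re q > 0))"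

definition density :: "nat \<Rightarrow> complex mat \<Rightarrow> bool" where
  "density d \<rho> \<longleftrightarrow> \<rho> \<in> carrier_mat d d \<and> psd \<rho> \<and> mtrace \<rho> = 1"

definition unitary :: "nat \<Rightarrow> complex mat \<Rightarrow> bool" where
  "unitary d U \<longleftrightarrow> U \<in> carrier_mat d d \<and> adj U * U = 1\<^sub>m d"

text \<open>Functional calculus for Hermitian matrices via spectral decomposition
  A = U diag(lambda) U^dagger; f(A) = U diag(f(lambda)) U^dagger (independent of the choice).\<close>
definition mat_fun :: "(real \<Rightarrow> real) \<Rightarrow> complex mat \<Rightarrow> complex mat" where
  "mat_fun f A = (SOME B. \<exists>U (lam :: nat \<Rightarrow> real).
      unitary (dim_row A) U \<and>
      A = U * mat_diag (dim_row A) (\<lambda>i. complex_of_real (lam i)) * adj U \<and>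
      B = U * mat_diag (dim_row A) (\<lambda>i. complex_of_real (f (lam i))) * adj U)"

definition mat_ln :: "complex mat \<Rightarrow> complex mat" where
  "mat_ln A = mat_fun ln A"

text \<open>von Neumann entropy S(rho) = - tr[rho ln rho] with 0 ln 0 = 0.\<close>
definition vn_entropy :: "complex mat \<Rightarrow> real" where
  "vn_entropy \<rho> = - Re (mtrace (mat_fun (\<lambda>x. x * ln x) \<rho>))"

text \<open>tr[rho ln sigma] (real for the density operators considered).\<close>
definition tr_ln :: "complex mat \<Rightarrow> complex mat \<Rightarrow> real" where
  "tr_ln \<rho> \<sigma> = Re (mtrace (\<rho> * mat_ln \<sigma>))"

definition linear_map :: "nat \<Rightarrow> (complex mat \<Rightarrow> complex mat) \<Rightarrow> bool" where
  "linear_map d E \<longleftrightarrow>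
     (\<forall>X \<in> carrier_mat d d. E X \<in> carrier_mat d d) \<and>
     (\<forall>X \<in> carrier_mat d d. \<forall>Y \<in> carrier_mat d d. \<forall>c :: complex.
         E (c \<cdot>\<^sub>m X + Y) = c \<cdot>\<^sub>m E X + E Y)"

text \<open>Complete positivity: E \<otimes> id_k is positive for every k; an element of
  L(C^d \<otimes> C^k) is represented as a (k*d) x (k*d) block matrix with k x k blocks of size d x d.\<close>
definition block :: "nat \<Rightarrow> complex mat \<Rightarrow> nat \<Rightarrow> nat \<Rightarrow> complex mat" where
  "block d X a b = mat d d (\<lambda>(r, s). X $$ (a * d + r, b * d + s))"

definition ampl :: "nat \<Rightarrow> nat \<Rightarrow> (complex mat \<Rightarrow> complex mat) \<Rightarrow> complex mat \<Rightarrow> complex mat" where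
  "ampl d k E X = mat (k * d) (k * d)
     (\<lambda>(i, j). E (block d X (i div d) (j div d)) $$ (i mod d, j mod d))"

definition completely_positive :: "nat \<Rightarrow> (complex mat \<Rightarrow> complex mat) \<Rightarrow> bool" where
  "completely_positive d E \<longleftrightarrow>
     (\<forall>k \<ge> 1. \<forall>X \<in> carrier_mat (k * d) (k * d). psd X \<longrightarrow> psd (ampl d k E X))"

definition trace_preserving :: "nat \<Rightarrow> (complex mat \<Rightarrow> complex mat) \<Rightarrow> bool" where
  "trace_preserving d E \<longleftrightarrow> (\<forall>X \<in> carrier_mat d d. mtrace (E X) = mtrace X)"

definition CPTP :: "nat \<Rightarrow> (complex mat \<Rightarrow> complex mat) \<Rightarrow> bool" where
  "CPTP d E \<longleftrightarrow> linear_map d E \<and> completely_positive d E \<and> trace_preserving d E"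

definition unique_pd_steady_state :: "nat \<Rightarrow> (complex mat \<Rightarrow> complex mat) \<Rightarrow> complex mat \<Rightarrow> bool" where
  "unique_pd_steady_state d E \<sigma> \<longleftrightarrow>
     density d \<sigma> \<and> E \<sigma> = \<sigma> \<and> pos_def \<sigma> \<and>
     (\<forall>\<tau>. density d \<tau> \<and> E \<tau> = \<tau> \<longrightarrow> \<tau> = \<sigma>)"

end

theory Submission
  imports Defs "Jordan_Normal_Form.Spectral_Radius"
begin

text \<open>
  The inequality telescopes into one step: if E is CPTP and fixes a positive definite \<sigma>, then
  the relative entropy \<open>D(\<rho>\<parallel>\<sigma>) = tr \<rho> ln \<rho> - tr \<rho> ln \<sigma>\<close> does not increase under E.
  Write \<open>\<rho> = \<Sum>\<^sub>i \<lambda>\<^sub>i |u\<^sub>i><u\<^sub>i|\<close>, \<open>\<sigma> = \<Sum>\<^sub>j \<mu>\<^sub>j |v\<^sub>j><v\<^sub>j|\<close> and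
  \<open>P\<^sub>i\<^sub>j = |<u\<^sub>i,v\<^sub>j>|\<^sup>2\<close>. For t \<open>\<ge>\<close> 0, completing squares in the two eigenbases gives
  \<open>g\<^sub>t(\<rho>,\<sigma>) := sup\<^sub>Z (2 Re tr(\<rho> Z) - t tr(Z\<^sup>* \<rho> Z) - tr(Z \<sigma> Z\<^sup>*)) = \<Sum>\<^sub>i\<^sub>j P\<^sub>i\<^sub>j \<lambda>\<^sub>i\<^sup>2 / (t \<lambda>\<^sub>i + \<mu>\<^sub>j)\<close>.
  The Schwarz inequality for the dual of E (two-positivity suffices) turns a competitor Y for
  \<open>(E \<rho>, \<sigma>)\<close> into the competitor \<open>Z = E\<^sup>*(Y)\<close> for \<open>(\<rho>, \<sigma>)\<close>, so \<open>g\<^sub>t\<close> decreases under E. Now \<open>g\<^sub>t\<close> is the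
  t-derivative of \<open>\<Sum>\<^sub>i\<^sub>j P\<^sub>i\<^sub>j \<lambda>\<^sub>i ln(t \<lambda>\<^sub>i + \<mu>\<^sub>j)\<close>, whose increment from t = 0 to t = T is
  \<open>D(\<rho>\<parallel>\<sigma>) + ln T + o(1)\<close> as \<open>T \<rightarrow> \<infinity>\<close>.
\<close>

section \<open>A comparison of weighted logarithms\<close>

text \<open>For a > 0 the difference of logarithms equals the logarithm of (a + b/t) / (1 + 1/t)
  once t > 0; for a = 0 the outer factor makes both sides 0. Subtracting \<open>ln (t + 1)\<close>
  removes the divergence.\<close>

lemma weighted_log_tendsto:
  fixes a b :: real
  assumes "0 \<le> a" "0 < b"
  shows "((\<lambda>t. a * (ln (t * a + b) - ln (t + 1))) \<longlongrightarrow> a * ln a) at_top"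
proof (cases "a = 0")
  case False
  then have a: "0 < a" using assms by simp
  have inv: "((\<lambda>t::real. inverse t) \<longlongrightarrow> 0) at_top"
    by (rule tendsto_inverse_0_at_top[OF filterlim_ident])
  have "((\<lambda>t. (a + b * inverse t) / (1 + inverse t)) \<longlongrightarrow> (a + b * 0) / (1 + 0)) at_top"
    by (intro tendsto_intros inv) simp
  then have "((\<lambda>t. ln ((a + b * inverse t) / (1 + inverse t))) \<longlongrightarrow> ln a) at_top"
    using tendsto_ln[of _ a] a by auto
  moreover have "eventually (\<lambda>t. ln ((a + b * inverse t) / (1 + inverse t))
      = ln (t * a + b) - ln (t + 1)) at_top"
    using eventually_gt_at_top[of 0]
  proof eventually_elim
    case (elim t)
    have "a + b * inverse t = (t * a + b) / t" "1 + inverse t = (t + 1) / t"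
      using elim by (simp_all add: field_simps)
    then have "(a + b * inverse t) / (1 + inverse t) = (t * a + b) / (t + 1)"
      using elim by simp
    moreover have "0 < t * a + b" "0 < t + 1" using elim a assms by (simp_all add: add_pos_pos)
    ultimately show ?case by (simp add: ln_div)
  qed
  ultimately have "((\<lambda>t. ln (t * a + b) - ln (t + 1)) \<longlongrightarrow> ln a) at_top"
    by (rule Lim_transform_eventually)
  then show ?thesis by (intro tendsto_intros)
qed simp

text \<open>The difference \<open>h\<close> of the two weighted sums of
  \<open>a * ln (t * a + b)\<close> has the difference of the resolvent sums as derivative, so it is
  nondecreasing for t \<ge> 0. Its value at 0 carries the terms with \<open>ln b\<close>, its limit
  at infinity those with \<open>ln a\<close>.\<close>

lemma weighted_log_ratio_mono:
  fixes w a b :: "'i \<Rightarrow> real" and w' a' b' :: "'j \<Rightarrow> real"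
  assumes "\<And>i. i \<in> I \<Longrightarrow> 0 \<le> a i" "\<And>i. i \<in> I \<Longrightarrow> 0 < b i"
    and "\<And>j. j \<in> J \<Longrightarrow> 0 \<le> a' j" "\<And>j. j \<in> J \<Longrightarrow> 0 < b' j"
    and total: "(\<Sum>i\<in>I. w i * a i) = (\<Sum>j\<in>J. w' j * a' j)"
    and resolvent: "\<And>t. 0 \<le> t \<Longrightarrow>
      (\<Sum>j\<in>J. w' j * (a' j)\<^sup>2 / (t * a' j + b' j)) \<le> (\<Sum>i\<in>I. w i * (a i)\<^sup>2 / (t * a i + b i))"
  shows "(\<Sum>j\<in>J. w' j * (a' j * ln (a' j) - a' j * ln (b' j)))
    \<le> (\<Sum>i\<in>I. w i * (a i * ln (a i) - a i * ln (b i)))"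
proof -
  define h where "h t = (\<Sum>i\<in>I. w i * (a i * ln (t * a i + b i)))
    - (\<Sum>j\<in>J. w' j * (a' j * ln (t * a' j + b' j)))" for t
  have pos: "i \<in> I \<Longrightarrow> 0 < t * a i + b i" "j \<in> J \<Longrightarrow> 0 < t * a' j + b' j" if "0 \<le> t" for i j t
    using that assms(1-4) by (simp_all add: add_nonneg_pos)
  have deriv: "(h has_real_derivative
      (\<Sum>i\<in>I. w i * (a i)\<^sup>2 / (t * a i + b i)) - (\<Sum>j\<in>J. w' j * (a' j)\<^sup>2 / (t * a' j + b' j))) (at t)"
    if "0 \<le> t" for t
  proof -
    have "((\<lambda>t. c * (x * ln (t * x + y))) has_real_derivative c * x\<^sup>2 / (t * x + y)) (at t)"
      if "0 < t * x + y" for c x y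
      using that by (auto intro!: derivative_eq_intros simp: power2_eq_square)
    then show ?thesis
      unfolding h_def using pos[OF \<open>0 \<le> t\<close>] by (intro DERIV_diff DERIV_sum) auto
  qed
  have le: "h 0 \<le> h t" if "0 \<le> t" for t
  proof (rule DERIV_nonneg_imp_nondecreasing[OF that])
    fix x assume "0 \<le> x" "x \<le> t"
    then show "\<exists>y. (h has_real_derivative y) (at x) \<and> 0 \<le> y"
      using deriv[of x] resolvent[of x]
      by (intro exI[of _ "(\<Sum>i\<in>I. w i * (a i)\<^sup>2 / (x * a i + b i))
        - (\<Sum>j\<in>J. w' j * (a' j)\<^sup>2 / (x * a' j + b' j))"]) simp
  qed
  \<comment> \<open>Because the totals agree, \<open>ln (t + 1)\<close> can be subtracted in both
    sums without changing \<open>h\<close>; afterwards every summand converges.\<close>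
  have h_eq: "h t = (\<Sum>i\<in>I. w i * (a i * (ln (t * a i + b i) - ln (t + 1))))
    - (\<Sum>j\<in>J. w' j * (a' j * (ln (t * a' j + b' j) - ln (t + 1))))" for t
  proof -
    have "(\<Sum>i\<in>I. w i * a i) * ln (t + 1) = (\<Sum>j\<in>J. w' j * a' j) * ln (t + 1)"
      by (simp add: total)
    then show ?thesis
      by (simp add: h_def right_diff_distrib sum_subtractf sum_distrib_right mult.assoc)
  qed
  have "(h \<longlongrightarrow> (\<Sum>i\<in>I. w i * (a i * ln (a i))) - (\<Sum>j\<in>J. w' j * (a' j * ln (a' j)))) at_top"
    unfolding h_eq[abs_def]
    by (intro tendsto_diff tendsto_sum tendsto_mult tendsto_const weighted_log_tendsto assms)
  then have "h 0 \<le> (\<Sum>i\<in>I. w i * (a i * ln (a i))) - (\<Sum>j\<in>J. w' j * (a' j * ln (a' j)))"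
    by (rule tendsto_lowerbound)
      (auto intro: eventually_mono[OF eventually_ge_at_top[of 0]] le)
  then show ?thesis by (simp add: h_def right_diff_distrib sum_subtractf)
qed

section \<open>The spectral theorem for Hermitian matrices\<close>

lemma adj_carrier [simp, intro]: "A \<in> carrier_mat m n \<Longrightarrow> adj A \<in> carrier_mat n m"
  by (simp add: adj_def)

lemma adj_index [simp]: "i < dim_col A \<Longrightarrow> j < dim_row A \<Longrightarrow> adj A $$ (i, j) = cnj (A $$ (j, i))"
  by (simp add: adj_def)

lemma adj_dim [simp]: "dim_row (adj A) = dim_col A" "dim_col (adj A) = dim_row A"
  by (simp_all add: adj_def)

lemma adj_adj [simp]: "adj (adj A) = A"
  by (rule eq_matI) auto

lemma adj_one [simp]: "adj (1\<^sub>m n) = 1\<^sub>m n"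
  by (rule eq_matI) auto

lemma mat_mult_index_sum:
  assumes "A \<in> carrier_mat m n" "B \<in> carrier_mat n k" "i < m" "j < k"
  shows "(A * B) $$ (i, j) = (\<Sum>l<n. A $$ (i, l) * B $$ (l, j))"
  using assms by (simp add: scalar_prod_def lessThan_atLeast0)

lemma adj_mult:
  assumes "A \<in> carrier_mat m n" "B \<in> carrier_mat n k"
  shows "adj (A * B) = adj B * adj A"
proof (rule eq_matI)
  fix i j assume "i < dim_row (adj B * adj A)" "j < dim_col (adj B * adj A)"
  then have ij: "i < k" "j < m" using assms by auto
  then show "adj (A * B) $$ (i, j) = (adj B * adj A) $$ (i, j)"
    using assms by (subst mat_mult_index_sum[of "adj B" k n "adj A" m])
      (auto simp: mat_mult_index_sum[OF assms ij(2,1)] mult.commute simp del: index_mult_mat(1))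
qed (use assms in auto)

text \<open>Serves as a rewrite system: adjoints move inside products, products associate to the
  right, and the first fact discharges the carrier conditions.\<close>

lemma square_mat_algebra:
  assumes "A \<in> carrier_mat n n" "B \<in> carrier_mat n n"
  shows "A * B \<in> carrier_mat n n" "adj (A * B) = adj B * adj A"
    "C \<in> carrier_mat n n \<Longrightarrow> A * B * C = A * (B * C)"
  using assms by (auto simp: adj_mult)

lemma unitaryD:
  assumes "unitary n U"
  shows "U \<in> carrier_mat n n" "adj U * U = 1\<^sub>m n" "U * adj U = 1\<^sub>m n"
proof -
  show U: "U \<in> carrier_mat n n" and UU: "adj U * U = 1\<^sub>m n" using assms by (auto simp: unitary_def)
  show "U * adj U = 1\<^sub>m n" by (rule mat_mult_left_right_inverse[OF _ U UU]) (simp add: U)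
qed

lemma unitary_mult:
  assumes "unitary n U" "unitary n V"
  shows "unitary n (U * V)"
proof -
  note c = unitaryD(1)[OF assms(1)] unitaryD(1)[OF assms(2)]
  have "adj (U * V) * (U * V) = adj V * (adj U * U) * V"
    using c by (simp add: square_mat_algebra[where n = n])
  then show ?thesis using c unitaryD(2)[OF assms(1)] unitaryD(2)[OF assms(2)]
    by (simp add: unitary_def)
qed

text \<open>Complete v to a basis and orthogonalise. Gram-Schmidt keeps the first vector and does
  not normalise, so each vector is divided by its length to give a column of W; c is the reciprocal
  of the length of v.\<close>

lemma unitary_with_first_column:
  assumes v: "v \<in> carrier_vec n" "v \<noteq> 0\<^sub>v n"
  obtains W c where "unitary n W" "c \<noteq> 0" "col W 0 = c \<cdot>\<^sub>v v"
proof -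
  interpret cof_vec_space n "TYPE(complex)" .
  define b where "b = basis_completion v"
  note bc = basis_completion[OF v, folded b_def]
  have n: "n > 0" using v by (cases n) auto
  obtain vs where bv: "b = v # vs" using bc(6,7) n by (cases b) auto
  define ws where "ws = gram_schmidt n b"
  note gs = gram_schmidt_result[OF bc(2,4,5) ws_def]
  have len: "length ws = n" using gs(4) bc(6) by simp
  have hd: "ws ! 0 = v"
    using gram_schmidt_hd[OF v(1), of vs] len n by (simp add: ws_def bv hd_conv_nth flip: length_greater_0_conv)
  have wsc: "ws ! i \<in> carrier_vec n" if "i < n" for i
    using gs(3) len that by (metis nth_mem subsetD)
  define s where "s i = (\<Sum>k<n. (cmod (ws ! i $ k))\<^sup>2)" for i
  have dot: "ws ! j \<bullet>c ws ! i = (\<Sum>k<n. cnj (ws ! i $ k) * ws ! j $ k)" if "i < n" "j < n" for i j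
    using wsc[OF that(1)] wsc[OF that(2)]
    by (simp add: scalar_prod_def lessThan_atLeast0 mult.commute)
  have dot_self: "ws ! i \<bullet>c ws ! i = complex_of_real (s i)" if "i < n" for i
    using that by (simp add: dot s_def complex_norm_square mult.commute del: of_real_power)
  have s_pos: "s i > 0" if "i < n" for i
  proof -
    have "complex_of_real (s i) \<noteq> 0"
      using corthogonalD[OF gs(2), of i i] that len by (simp flip: dot_self)
    moreover have "s i \<ge> 0" by (simp add: s_def sum_nonneg)
    ultimately show ?thesis by simp
  qed
  define r where "r i = complex_of_real (1 / sqrt (s i))" for i
  have r: "r i * r i * complex_of_real (s i) = 1" if "i < n" for i
    using s_pos[OF that] by (simp add: r_def flip: of_real_mult)
  define W where "W = mat n n (\<lambda>(k, i). r i * ws ! i $ k)"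
  have Wc: "W \<in> carrier_mat n n" by (simp add: W_def)
  have "adj W * W = 1\<^sub>m n"
  proof (rule eq_matI)
    fix i j assume "i < dim_row (1\<^sub>m n :: complex mat)" "j < dim_col (1\<^sub>m n :: complex mat)"
    then have ij: "i < n" "j < n" by auto
    have "(adj W * W) $$ (i, j) = (\<Sum>k<n. r i * r j * (cnj (ws ! i $ k) * ws ! j $ k))"
      using ij by (subst mat_mult_index_sum[of _ n n _ n]) (auto simp: W_def r_def intro!: sum.cong)
    also have "\<dots> = r i * r j * (ws ! j \<bullet>c ws ! i)"
      by (simp add: dot[OF ij] sum_distrib_left)
    also have "\<dots> = 1\<^sub>m n $$ (i, j)"
      using corthogonalD[OF gs(2), of j i] ij len r[of i] by (auto simp: dot_self)
    finally show "(adj W * W) $$ (i, j) = 1\<^sub>m n $$ (i, j)" .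
  qed (use Wc in auto)
  moreover have "col W 0 = r 0 \<cdot>\<^sub>v v"
    using n v(1) by (intro eq_vecI) (auto simp: W_def hd)
  moreover have "r 0 \<noteq> 0" using r[OF n] by auto
  ultimately show ?thesis using that Wc by (auto simp: unitary_def)
qed

text \<open>Deflation: an eigenvector becomes the first column of a unitary W. In that basis the
  first column of A is (e, 0, ..., 0), by Hermitian symmetry so is the first row, and the induction
  hypothesis diagonalises the remaining block.\<close>

lemma spectral_theorem:
  assumes "A \<in> carrier_mat n n" "adj A = A"
  shows "\<exists>U (lam :: nat \<Rightarrow> real). unitary n U \<and>
    A = U * mat_diag n (\<lambda>i. complex_of_real (lam i)) * adj U"
  using assms
proof (induction n arbitrary: A)
  case 0
  then have "A = 1\<^sub>m 0 * mat_diag 0 (\<lambda>i. complex_of_real 0) * adj (1\<^sub>m 0)"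
    by (intro eq_matI) auto
  moreover have "unitary 0 (1\<^sub>m 0)" by (simp add: unitary_def)
  ultimately show ?case by (intro exI[of _ "1\<^sub>m 0"] exI[of _ "\<lambda>_. 0"]) simp
next
  case (Suc n)
  note A = Suc.prems and alg = square_mat_algebra[where n = "Suc n"]
  obtain e where "eigenvalue A e"
    using spectrum_non_empty[OF A(1)] by (auto simp: spectrum_def)
  then obtain v where v: "v \<in> carrier_vec (Suc n)" "v \<noteq> 0\<^sub>v (Suc n)" "A *\<^sub>v v = e \<cdot>\<^sub>v v"
    using A(1) by (auto simp: eigenvalue_def eigenvector_def)
  obtain W c where W: "unitary (Suc n) W" and colW: "col W 0 = c \<cdot>\<^sub>v v"
    using unitary_with_first_column[OF v(1,2)] by metis
  note Wc = unitaryD(1)[OF W] and WW = unitaryD(2,3)[OF W]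
  define A' where "A' = adj W * A * W"
  have A'c: "A' \<in> carrier_mat (Suc n) (Suc n)" using A Wc by (auto simp: A'_def)
  have A'h: "adj A' = A'"
    using A Wc by (simp add: A'_def alg)
  have "col (A * W) 0 = c \<cdot>\<^sub>v (A *\<^sub>v v)"
    using col_mult2[OF A(1) Wc, of 0] mult_mat_vec[OF A(1) v(1), of c] by (simp add: colW)
  then have "col (A * W) 0 = e \<cdot>\<^sub>v col W 0"
    by (simp add: v colW smult_smult_assoc mult.commute)
  then have AW: "(A * W) $$ (k, 0) = e * W $$ (k, 0)" if "k < Suc n" for k
    using that A Wc index_col[of k "A * W" 0] by (simp del: index_mult_mat(1) col_mult2)
  \<comment> \<open>The first column of \<open>A * W\<close> is e times that of W, and
    \<open>adj W\<close> sends the latter to the first column of the identity.\<close>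
  have col0: "A' $$ (i, 0) = (if i = 0 then e else 0)" if "i < Suc n" for i
  proof -
    have "A' $$ (i, 0) = (\<Sum>k<Suc n. adj W $$ (i, k) * (A * W) $$ (k, 0))"
      using A Wc that mat_mult_index_sum[of "adj W" "Suc n" "Suc n" "A * W" "Suc n" i 0]
      by (simp add: A'_def alg del: index_mult_mat(1) sum.lessThan_Suc)
    also have "\<dots> = (\<Sum>k<Suc n. e * (adj W $$ (i, k) * W $$ (k, 0)))"
      by (intro sum.cong) (auto simp: AW)
    also have "\<dots> = e * (adj W * W) $$ (i, 0)"
      using Wc that by (subst mat_mult_index_sum[of "adj W" "Suc n" "Suc n" W "Suc n"])
        (auto simp: sum_distrib_left simp del: sum.lessThan_Suc)
    finally show ?thesis using that by (simp add: WW)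
  qed
  have sym: "A' $$ (j, i) = cnj (A' $$ (i, j))" if "i < Suc n" "j < Suc n" for i j
    using that A'c by (subst (1) A'h[symmetric]) auto
  have e: "e = complex_of_real (Re e)" using sym[of 0 0] col0[of 0] by (simp add: complex_eq_iff)
  define A3 where "A3 = mat n n (\<lambda>(i, j). A' $$ (Suc i, Suc j))"
  have A3: "A3 \<in> carrier_mat n n" "adj A3 = A3"
    by (auto simp: A3_def intro!: eq_matI) (metis sym Suc_less_eq)
  obtain U3 lam where U3: "unitary n U3" and A3eq: "A3 = U3 * mat_diag n (\<lambda>i. complex_of_real (lam i)) * adj U3"
    using Suc.IH[OF A3] by blast
  note U3c = unitaryD(1)[OF U3]
  \<comment> \<open>The direct sum of a scalar and a matrix. It respects products and adjoints, so
    the diagonalisation of \<open>A3\<close> lifts to one of \<open>A'\<close>.\<close>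
  define F where "F x X = four_block_mat (x \<cdot>\<^sub>m 1\<^sub>m 1) (0\<^sub>m 1 n) (0\<^sub>m n 1) X"
    for x :: complex and X
  have Fmult: "F x X * F y Y = F (x * y) (X * Y)" if "X \<in> carrier_mat n n" "Y \<in> carrier_mat n n" for x y X Y
    unfolding F_def using that by (subst mult_four_block_mat[of _ 1 1 _ n _ n]) (auto intro!: arg_cong4[of _ _ _ _ _ _ _ _ four_block_mat] eq_matI)
  have Fadj: "adj (F x X) = F (cnj x) (adj X)" if "X \<in> carrier_mat n n" for x X
    unfolding F_def using that by (intro eq_matI) auto
  have Fc: "F x X \<in> carrier_mat (Suc n) (Suc n)" if "X \<in> carrier_mat n n" for x X
    unfolding F_def using that by auto
  have F_one: "F 1 (1\<^sub>m n) = 1\<^sub>m (Suc n)" unfolding F_def by (intro eq_matI) auto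
  define U where "U = W * F 1 U3"
  define mu where "mu i = (case i of 0 \<Rightarrow> Re e | Suc j \<Rightarrow> lam j)" for i
  have D: "mat_diag (Suc n) (\<lambda>i. complex_of_real (mu i)) = F e (mat_diag n (\<lambda>i. complex_of_real (lam i)))"
    unfolding F_def using e by (intro eq_matI) (auto simp: mat_diag_def mu_def split: nat.split)
  have A'F: "A' = F e A3"
  proof (rule eq_matI)
    fix i j assume "i < dim_row (F e A3)" "j < dim_col (F e A3)"
    then have ij: "i < Suc n" "j < Suc n" using Fc[OF A3(1), of e] by auto
    show "A' $$ (i, j) = F e A3 $$ (i, j)"
      using ij A3 col0[of i] col0[of j] sym[of j i]
      by (cases i; cases j) (auto simp: A3_def F_def)
  qed (use A'c Fc[OF A3(1), of e] in auto)
  have "unitary (Suc n) (F 1 U3)"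
    using U3c Fc[OF U3c] unitaryD(2)[OF U3]
    by (simp add: unitary_def Fadj Fmult F_one)
  then have "unitary (Suc n) U" unfolding U_def by (rule unitary_mult[OF W])
  moreover have "A = U * mat_diag (Suc n) (\<lambda>i. complex_of_real (mu i)) * adj U"
  proof -
    have "U * mat_diag (Suc n) (\<lambda>i. complex_of_real (mu i)) * adj U
      = W * (F 1 U3 * F e (mat_diag n (\<lambda>i. complex_of_real (lam i))) * adj (F 1 U3)) * adj W"
      unfolding U_def D using Wc Fc[OF U3c] Fc[of "mat_diag n (\<lambda>i. complex_of_real (lam i))"]
      by (simp add: alg)
    also have "F 1 U3 * F e (mat_diag n (\<lambda>i. complex_of_real (lam i))) * adj (F 1 U3) = A'"
      using U3c by (simp add: Fadj Fmult A'F A3eq)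
    also have "W * A' * adj W = (W * adj W) * A * (W * adj W)"
      unfolding A'_def using A Wc by (simp add: alg)
    finally show ?thesis using A by (simp add: WW)
  qed
  ultimately show ?case by blast
qed

section \<open>Positive semidefinite matrices and amplifications\<close>

lemma mtrace_mult:
  assumes "A \<in> carrier_mat m n" "B \<in> carrier_mat n m"
  shows "mtrace (A * B) = (\<Sum>i<m. \<Sum>j<n. A $$ (i, j) * B $$ (j, i))"
  using assms by (simp add: mtrace_def mat_mult_index_sum[OF assms] del: index_mult_mat(1))

lemma mtrace_mult_commute:
  assumes "A \<in> carrier_mat m n" "B \<in> carrier_mat n m"
  shows "mtrace (A * B) = mtrace (B * A)"
  unfolding mtrace_mult[OF assms] mtrace_mult[OF assms(2,1)]
  by (subst sum.swap) (simp add: mult.commute)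

lemma mtrace_adj: "A \<in> carrier_mat n n \<Longrightarrow> mtrace (adj A) = cnj (mtrace A)"
  by (simp add: mtrace_def)

lemma adj_sandwich_index:
  assumes "X \<in> carrier_mat n m" "A \<in> carrier_mat n n" "Y \<in> carrier_mat n k" "i < m" "j < k"
  shows "(adj X * A * Y) $$ (i, j) = (\<Sum>p<n. \<Sum>q<n. cnj (X $$ (p, i)) * A $$ (p, q) * Y $$ (q, j))"
proof -
  have "(adj X * A * Y) $$ (i, j) = (\<Sum>q<n. (\<Sum>p<n. adj X $$ (i, p) * A $$ (p, q)) * Y $$ (q, j))"
    using assms mat_mult_index_sum[of "adj X" m n A n i]
    by (subst mat_mult_index_sum[of _ m n _ k]) (auto intro!: sum.cong simp del: index_mult_mat(1))
  also have "\<dots> = (\<Sum>q<n. \<Sum>p<n. cnj (X $$ (p, i)) * A $$ (p, q) * Y $$ (q, j))"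
    using assms by (auto simp: sum_distrib_right intro!: sum.cong)
  finally show ?thesis by (subst sum.swap)
qed

lemma adj_sandwich:
  assumes "A \<in> carrier_mat n n" "G \<in> carrier_mat m n"
  shows "adj (G * A * adj G) = G * adj A * adj G"
proof -
  have "adj (G * A * adj G) = adj (adj G) * adj (G * A)"
    using assms by (intro adj_mult[of _ m n _ m]) auto
  also have "\<dots> = G * (adj A * adj G)"
    using assms by (simp add: adj_mult[of G m n A n])
  also have "\<dots> = G * adj A * adj G"
    using assms by (intro assoc_mult_mat[of _ m n _ n _ m, symmetric]) auto
  finally show ?thesis .
qed

lemma hermitian_iff: "A \<in> carrier_mat n n \<Longrightarrow> hermitian A \<longleftrightarrow> adj A = A"
  by (auto simp: hermitian_def)

lemma quadratic_form_eq:
  assumes "A \<in> carrier_mat n n" "v \<in> carrier_vec n"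
  shows "(\<Sum>i<n. cnj (v $ i) * (A *\<^sub>v v) $ i)
    = (adj (mat n 1 (\<lambda>(i, j). v $ i)) * A * mat n 1 (\<lambda>(i, j). v $ i)) $$ (0, 0)"
  using assms
  by (subst adj_sandwich_index[of _ n 1 _ _ 1])
    (auto simp: scalar_prod_def lessThan_atLeast0 sum_distrib_left mult.assoc intro!: sum.cong)

text \<open>Vectors become one-column matrices, so positivity can be handled by matrix algebra. The
  imaginary part vanishes because the 1 x 1 matrix \<open>adj C * A * C\<close> is its own adjoint,
  which leaves the sign of the real part.\<close>

lemma psd_iff:
  assumes A: "A \<in> carrier_mat n n"
  shows "psd A \<longleftrightarrow> adj A = A \<and>
    (\<forall>C \<in> carrier_mat n 1. 0 \<le> Re ((adj C * A * C) $$ (0, 0)))" (is "?L \<longleftrightarrow> ?R")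
proof
  have dim: "dim_row A = n" using A by simp
  assume L: ?L
  have "0 \<le> Re ((adj C * A * C) $$ (0, 0))" if C: "C \<in> carrier_mat n 1" for C
  proof -
    have "mat n 1 (\<lambda>(i, j). col C 0 $ i) = C" using C by (intro eq_matI) auto
    moreover have c: "col C 0 \<in> carrier_vec n" using C by (intro carrier_vecI) simp
    moreover have "0 \<le> Re (\<Sum>i<n. cnj (col C 0 $ i) * (A *\<^sub>v col C 0) $ i)"
      using L c unfolding psd_def Let_def dim by blast
    ultimately show ?thesis using quadratic_form_eq[OF A c] by simp
  qed
  then show ?R using L A by (auto simp: psd_def hermitian_iff)
next
  have dim: "dim_row A = n" using A by simp
  assume R: ?R
  have "Im q = 0 \<and> 0 \<le> Re q" if v: "v \<in> carrier_vec n" and q: "q = (\<Sum>i<n. cnj (v $ i) * (A *\<^sub>v v) $ i)" for v q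
  proof -
    let ?C = "mat n 1 (\<lambda>(i, j). v $ i)"
    have c: "?C \<in> carrier_mat n 1" by simp
    have h: "adj (adj ?C * A * ?C) = adj ?C * A * ?C"
      using adj_sandwich[OF A, of "adj ?C" 1] c R by simp
    have "cnj ((adj ?C * A * ?C) $$ (0, 0)) = (adj ?C * A * ?C) $$ (0, 0)"
      by (subst (2) h[symmetric]) (use A in \<open>simp del: index_mult_mat(1)\<close>)
    then show ?thesis
      using R c by (auto simp: q quadratic_form_eq[OF A v] complex_eq_iff simp del: index_mult_mat(1))
  qed
  then show ?L using R A unfolding psd_def by (auto simp: Let_def dim hermitian_iff)
qed

text \<open>The quadratic form of \<open>G * A * adj G\<close> at C is that of A at
  \<open>adj G * C\<close>. G may be rectangular, as the block columns used below are.\<close>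

lemma psd_sandwich:
  assumes A: "A \<in> carrier_mat n n" "psd A" and G: "G \<in> carrier_mat m n"
  shows "psd (G * A * adj G)"
proof -
  have c: "G * A * adj G \<in> carrier_mat m m" using A G by (intro carrier_matI) auto
  have h: "adj A = A" using A psd_iff by auto
  have "adj (G * A * adj G) = G * A * adj G"
    using adj_sandwich[OF A(1) G] h by simp
  moreover have "0 \<le> Re ((adj C * (G * A * adj G) * C) $$ (0, 0))" if C: "C \<in> carrier_mat m 1" for C
  proof -
    have "adj C * (G * A * adj G) = adj C * (G * A) * adj G"
      using A G C by (intro assoc_mult_mat[of _ 1 m _ n _ m, symmetric]) auto
    also have "adj C * (G * A) = adj C * G * A"
      using A G C by (intro assoc_mult_mat[of _ 1 m _ n _ n, symmetric]) auto
    also have "adj C * G = adj (adj G * C)"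
      using G C by (simp add: adj_mult[of _ n m _ 1])
    finally have "adj C * (G * A * adj G) * C = adj (adj G * C) * A * adj G * C" by simp
    also have "\<dots> = adj (adj G * C) * A * (adj G * C)"
      using A G C by (intro assoc_mult_mat[of _ 1 n _ m _ 1]) auto
    finally have "adj C * (G * A * adj G) * C = adj (adj G * C) * A * (adj G * C)" .
    moreover have "adj G * C \<in> carrier_mat n 1" using G C by (intro carrier_matI) auto
    ultimately show ?thesis using A(2) psd_iff[OF A(1)] by (simp del: index_mult_mat(1))
  qed
  ultimately show ?thesis using psd_iff[OF c] by blast
qed

lemma psd_diag_entry:
  assumes A: "A \<in> carrier_mat n n" "psd A" and C: "C \<in> carrier_mat n m" and k: "k < m"
  shows "0 \<le> Re ((adj C * A * C) $$ (k, k))"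
proof -
  let ?c = "mat n 1 (\<lambda>(i, j). C $$ (i, k))"
  have "(adj C * A * C) $$ (k, k) = (adj ?c * A * ?c) $$ (0, 0)"
    using assms by (subst adj_sandwich_index[of _ n m _ _ m]; (subst adj_sandwich_index[of _ n 1 _ _ 1])?) auto
  then show ?thesis using A psd_iff[OF A(1)] by (simp del: index_mult_mat(1))
qed

lemma mtrace_sandwich_nonneg:
  assumes A: "A \<in> carrier_mat n n" "psd A" and C: "C \<in> carrier_mat n m"
  shows "0 \<le> Re (mtrace (adj C * A * C))"
  using C psd_diag_entry[OF assms]
  by (auto simp: mtrace_def intro!: sum_nonneg simp del: index_mult_mat(1))

text \<open>The entry is the quadratic form of A at the k-th column of U. That column is nonzero,
  since otherwise \<open>adj U * U\<close> would have a zero on its diagonal.\<close>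

lemma pos_def_diag_entry:
  assumes A: "A \<in> carrier_mat n n" "pos_def A" and U: "unitary n U" and k: "k < n"
  shows "0 < Re ((adj U * A * U) $$ (k, k))"
proof -
  note Uc = unitaryD(1)[OF U]
  let ?v = "col U k"
  have v: "?v \<in> carrier_vec n" using Uc by (intro carrier_vecI) simp
  have "?v \<noteq> 0\<^sub>v n"
  proof
    assume z: "?v = 0\<^sub>v n"
    have "U $$ (l, k) = 0" if "l < n" for l
      using arg_cong[OF z, of "\<lambda>x. x $ l"] that k Uc by simp
    then have "(adj U * U) $$ (k, k) = 0"
      using Uc k by (subst mat_mult_index_sum[of _ n n _ n]) auto
    then show False using unitaryD(2)[OF U] k by simp
  qed
  then have "0 < Re (\<Sum>i<n. cnj (?v $ i) * (A *\<^sub>v ?v) $ i)"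
    using A v by (auto simp: pos_def_def Let_def)
  also have "(\<Sum>i<n. cnj (?v $ i) * (A *\<^sub>v ?v) $ i) = (adj U * A * U) $$ (k, k)"
    using A v Uc k unfolding quadratic_form_eq[OF A(1) v]
    by (subst adj_sandwich_index[of _ n 1 _ _ 1]; (subst adj_sandwich_index[of _ n n _ _ n])?) auto
  finally show ?thesis .
qed

section \<open>Block columns and the trace form of complete positivity\<close>

text \<open>The block column with blocks F 0, ..., F (k - 1), indexed as in \<open>block\<close>.
  Sandwiching A between it and its adjoint produces the matrix with blocks
  \<open>F a * A * adj (F b)\<close>.\<close>

definition stack :: "nat \<Rightarrow> nat \<Rightarrow> (nat \<Rightarrow> complex mat) \<Rightarrow> complex mat" where
  "stack d k F = mat (k * d) d (\<lambda>(i, j). F (i div d) $$ (i mod d, j))"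

lemma stack_carrier [simp, intro]: "stack d k F \<in> carrier_mat (k * d) d"
  by (simp add: stack_def)

lemma block_index_less: "a < k \<Longrightarrow> r < d \<Longrightarrow> a * d + r < k * (d :: nat)"
  using mult_le_mono1[of "Suc a" k d] by simp

lemma stack_index [simp]:
  "a < k \<Longrightarrow> r < d \<Longrightarrow> s < d \<Longrightarrow> stack d k F $$ (a * d + r, s) = F a $$ (r, s)"
  by (simp add: stack_def block_index_less)

lemma block_carrier [simp, intro]: "block d X a b \<in> carrier_mat d d"
  by (simp add: block_def)

lemma block_stack_sandwich:
  assumes "\<And>a. a < k \<Longrightarrow> F a \<in> carrier_mat d d" "A \<in> carrier_mat d d" "a < k" "b < k"
  shows "block d (stack d k F * A * adj (stack d k F)) a b = F a * A * adj (F b)"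
proof (rule eq_matI)
  fix r s assume "r < dim_row (F a * A * adj (F b))" "s < dim_col (F a * A * adj (F b))"
  then have rs: "r < d" "s < d" using assms(1)[OF assms(3)] assms(1)[OF assms(4)] by auto
  have i: "a * d + r < k * d" "b * d + s < k * d" using assms rs by (simp_all add: block_index_less)
  have "block d (stack d k F * A * adj (stack d k F)) a b $$ (r, s)
    = (\<Sum>p<d. \<Sum>q<d. F a $$ (r, p) * A $$ (p, q) * cnj (F b $$ (s, q)))"
    using adj_sandwich_index[of "adj (stack d k F)" d "k * d" A "adj (stack d k F)" "k * d", OF _ assms(2) _ i]
      rs i assms stack_carrier[of d k F] by (simp add: block_def del: index_mult_mat(1))
  also have "\<dots> = (F a * A * adj (F b)) $$ (r, s)"
    using adj_sandwich_index[of "adj (F a)" d d A "adj (F b)" d r s] rs assms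
      assms(1)[OF assms(3)] assms(1)[OF assms(4)]
    by (simp del: index_mult_mat(1))
  finally show "block d (stack d k F * A * adj (stack d k F)) a b $$ (r, s) = (F a * A * adj (F b)) $$ (r, s)" .
qed (use assms(1)[OF assms(3)] assms(1)[OF assms(4)] in \<open>auto simp: block_def\<close>)

lemma sum_block: "(\<Sum>i<k * d. f i) = (\<Sum>a<k. \<Sum>r<d. f (a * d + r))"
  for f :: "nat \<Rightarrow> 'a :: comm_monoid_add"
proof -
  have "(\<Sum>i<k * d. f i) = (\<Sum>a<k. sum f {a * d..<a * d + d})" by (simp add: sum.nat_group)
  moreover have "sum f {a * d..<a * d + d} = (\<Sum>r<d. f (a * d + r))" for a
    by (rule sum.reindex_bij_witness[of _ "\<lambda>r. a * d + r" "\<lambda>i. i - a * d"]) auto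
  ultimately show ?thesis by simp
qed

text \<open>Each flat index splits into a block index and an inner index by
  \<open>sum_block\<close>; interchanging finite sums then brings the block indices
  outermost.\<close>

lemma mtrace_stack_sandwich:
  assumes F: "\<And>a. a < k \<Longrightarrow> F a \<in> carrier_mat d d" and X: "X \<in> carrier_mat (k * d) (k * d)"
  shows "mtrace (adj (stack d k F) * X * stack d k F)
    = (\<Sum>a<k. \<Sum>b<k. mtrace (adj (F a) * block d X a b * F b))"
proof -
  have "mtrace (adj (stack d k F) * X * stack d k F)
    = (\<Sum>i<d. \<Sum>a<k. \<Sum>r<d. \<Sum>b<k. \<Sum>s<d. cnj (F a $$ (r, i)) * X $$ (a * d + r, b * d + s) * F b $$ (s, i))"
    using X stack_carrier[of d k F]
    by (simp add: mtrace_def adj_sandwich_index[of _ "k * d" d _ _ d] sum_block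
        carrier_matD(2)[OF stack_carrier] del: index_mult_mat(1))
  also have "\<dots> = (\<Sum>i<d. \<Sum>a<k. \<Sum>b<k. \<Sum>r<d. \<Sum>s<d. cnj (F a $$ (r, i)) * X $$ (a * d + r, b * d + s) * F b $$ (s, i))"
    by (intro sum.cong refl sum.swap)
  also have "\<dots> = (\<Sum>a<k. \<Sum>b<k. \<Sum>i<d. \<Sum>r<d. \<Sum>s<d. cnj (F a $$ (r, i)) * X $$ (a * d + r, b * d + s) * F b $$ (s, i))"
    by (subst sum.swap) (intro sum.cong refl sum.swap)
  also have "\<dots> = (\<Sum>a<k. \<Sum>b<k. mtrace (adj (F a) * block d X a b * F b))"
  proof (intro sum.cong refl)
    fix a b assume "a \<in> {..<k}" "b \<in> {..<k}"
    then have F': "F a \<in> carrier_mat d d" "F b \<in> carrier_mat d d" using F by auto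
    then have "mtrace (adj (F a) * block d X a b * F b) = (\<Sum>i<d. (adj (F a) * block d X a b * F b) $$ (i, i))"
      by (simp add: mtrace_def del: index_mult_mat(1))
    also have "\<dots> = (\<Sum>i<d. \<Sum>r<d. \<Sum>s<d. cnj (F a $$ (r, i)) * X $$ (a * d + r, b * d + s) * F b $$ (s, i))"
      using F' by (intro sum.cong refl, subst adj_sandwich_index[of _ d d _ _ d]) (auto simp: block_def)
    finally show "(\<Sum>i<d. \<Sum>r<d. \<Sum>s<d. cnj (F a $$ (r, i)) * X $$ (a * d + r, b * d + s) * F b $$ (s, i))
      = mtrace (adj (F a) * block d X a b * F b)" by simp
  qed
  finally show ?thesis .
qed

lemma block_ampl:
  assumes "a < k" "b < k" "E (block d X a b) \<in> carrier_mat d d"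
  shows "block d (ampl d k E X) a b = E (block d X a b)"
  using assms by (intro eq_matI) (auto simp: block_def ampl_def block_index_less)

text \<open>The amplified map sends the positive matrix with blocks
  \<open>F a * A * adj (F b)\<close> to a positive one. Sandwiching the image with the block column
  of C gives the inequality; comparing opposite blocks of the Hermitian image gives the adjoint
  rule. Both later uses take k = 2.\<close>

lemma completely_positive_trace:
  assumes E: "Defs.linear_map d E" "completely_positive d E"
    and A: "A \<in> carrier_mat d d" "psd A" and k: "(k :: nat) \<ge> 1"
    and F: "\<And>a. a < k \<Longrightarrow> F a \<in> carrier_mat d d" and C: "\<And>a. a < k \<Longrightarrow> C a \<in> carrier_mat d d"
  shows "0 \<le> Re (\<Sum>a<k. \<Sum>b<k. mtrace (adj (C a) * E (F a * A * adj (F b)) * C b))"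
    and "a < k \<Longrightarrow> b < k \<Longrightarrow> adj (E (F a * A * adj (F b))) = E (F b * A * adj (F a))"
proof -
  define X where "X = stack d k F * A * adj (stack d k F)"
  have X: "X \<in> carrier_mat (k * d) (k * d)" "psd X"
    using A psd_sandwich[OF A stack_carrier] stack_carrier[of d k F]
    by (auto simp: X_def intro!: carrier_matI simp del: stack_carrier)
  have psd: "psd (ampl d k E X)" using E(2) X k by (auto simp: completely_positive_def)
  have amp: "ampl d k E X \<in> carrier_mat (k * d) (k * d)" by (simp add: ampl_def)
  have EX: "block d (ampl d k E X) a b = E (F a * A * adj (F b))" if "a < k" "b < k" for a b
  proof -
    have "block d X a b = F a * A * adj (F b)"
      unfolding X_def by (rule block_stack_sandwich) (use F A that in auto)
    then show ?thesis
      using block_ampl[OF that, of E d X] E(1) by (metis Defs.linear_map_def block_carrier)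
  qed
  have "(\<Sum>a<k. \<Sum>b<k. mtrace (adj (C a) * E (F a * A * adj (F b)) * C b))
    = mtrace (adj (stack d k C) * ampl d k E X * stack d k C)"
    by (simp add: mtrace_stack_sandwich[OF C amp] EX)
  then show "0 \<le> Re (\<Sum>a<k. \<Sum>b<k. mtrace (adj (C a) * E (F a * A * adj (F b)) * C b))"
    using mtrace_sandwich_nonneg[OF amp psd stack_carrier] by simp
  assume ab: "a < k" "b < k"
  have h: "adj (ampl d k E X) = ampl d k E X" using psd psd_iff[OF amp] by blast
  have "adj (block d (ampl d k E X) a b) = block d (adj (ampl d k E X)) b a"
    using ab amp by (intro eq_matI) (auto simp: block_def block_index_less)
  then show "adj (E (F a * A * adj (F b))) = E (F b * A * adj (F a))"
    by (simp add: h EX ab)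
qed

section \<open>The dual map for the trace pairing\<close>

text \<open>Expand W in the matrix units \<open>e (i, j)\<close>; the representing matrix collects
  the values of the functional on them.\<close>

lemma linear_functional_trace:
  fixes \<phi> :: "complex mat \<Rightarrow> complex"
  assumes lin: "\<And>X Y c. X \<in> carrier_mat d d \<Longrightarrow> Y \<in> carrier_mat d d \<Longrightarrow> \<phi> (c \<cdot>\<^sub>m X + Y) = c * \<phi> X + \<phi> Y"
  obtains Z where "Z \<in> carrier_mat d d" "\<And>W. W \<in> carrier_mat d d \<Longrightarrow> \<phi> W = mtrace (W * Z)"
proof -
  define e where "e p = mat d d (\<lambda>q. if q = p then 1 else (0::complex))" for p
  have zero: "\<phi> (0\<^sub>m d d) = 0"
    using lin[of "0\<^sub>m d d" "0\<^sub>m d d" 1] by simp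
  \<comment> \<open>The expansion is built one entry at a time, by induction on the set S of entries
    kept, because linearity is given for two summands only.\<close>
  have exp: "\<phi> (mat d d (\<lambda>p. if p \<in> S then W $$ p else 0)) = (\<Sum>p\<in>S. W $$ p * \<phi> (e p))"
    if "finite S" for S and W :: "complex mat"
    using that
  proof (induction S)
    case empty
    have "mat d d (\<lambda>p. 0) = (0\<^sub>m d d :: complex mat)" by (intro eq_matI) auto
    then show ?case using zero by simp
  next
    case (insert p S)
    have "mat d d (\<lambda>q. if q \<in> insert p S then W $$ q else 0)
      = W $$ p \<cdot>\<^sub>m e p + mat d d (\<lambda>q. if q \<in> S then W $$ q else 0)"
      using insert by (intro eq_matI) (auto simp: e_def)
    then show ?case using insert lin[of "e p" "mat d d (\<lambda>q. if q \<in> S then W $$ q else 0)"]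
      by (simp add: e_def)
  qed
  \<comment> \<open>The indices are transposed because the trace of \<open>W * Z\<close> pairs entry
    (i, j) of W with entry (j, i) of Z.\<close>
  define Z where "Z = mat d d (\<lambda>(i, j). \<phi> (e (j, i)))"
  have Zc: "Z \<in> carrier_mat d d" by (simp add: Z_def)
  have "\<phi> W = mtrace (W * Z)" if W: "W \<in> carrier_mat d d" for W
  proof -
    have "mat d d (\<lambda>p. if p \<in> {..<d} \<times> {..<d} then W $$ p else 0) = W"
      using W by (intro eq_matI) auto
    then have "\<phi> W = (\<Sum>p\<in>{..<d} \<times> {..<d}. W $$ p * \<phi> (e p))"
      using exp[of "{..<d} \<times> {..<d}" W] by simp
    also have "\<dots> = (\<Sum>i<d. \<Sum>j<d. W $$ (i, j) * \<phi> (e (i, j)))"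
      by (simp add: sum.cartesian_product case_prod_unfold)
    also have "\<dots> = mtrace (W * Z)"
      unfolding mtrace_mult[OF W Zc] by (simp add: Z_def)
    finally show ?thesis .
  qed
  then show ?thesis using that Zc by blast
qed

lemma mtrace_linear:
  "X \<in> carrier_mat n n \<Longrightarrow> Y \<in> carrier_mat n n \<Longrightarrow> mtrace (c \<cdot>\<^sub>m X + Y) = c * mtrace X + mtrace Y"
  by (simp add: mtrace_def sum.distrib sum_distrib_left)

text \<open>Z is the value at Y of the dual of E with respect to the bilinear pairing tr(W
  Z).\<close>

lemma dual_matrix:
  assumes E: "Defs.linear_map d E" and Y: "Y \<in> carrier_mat d d"
  obtains Z where "Z \<in> carrier_mat d d" "\<And>W. W \<in> carrier_mat d d \<Longrightarrow> mtrace (E W * Y) = mtrace (W * Z)"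
proof (rule linear_functional_trace[of d "\<lambda>W. mtrace (E W * Y)"])
  fix X X' :: "complex mat" and c
  assume X: "X \<in> carrier_mat d d" "X' \<in> carrier_mat d d"
  then have EX: "E X \<in> carrier_mat d d" "E X' \<in> carrier_mat d d" "E (c \<cdot>\<^sub>m X + X') = c \<cdot>\<^sub>m E X + E X'"
    using E by (auto simp: Defs.linear_map_def)
  have "(c \<cdot>\<^sub>m E X + E X') * Y = c \<cdot>\<^sub>m (E X * Y) + E X' * Y"
    using EX Y by (simp add: add_mult_distrib_mat[of _ d d _ _ d] mult_smult_assoc_mat[of _ d d _ d])
  then show "mtrace (E (c \<cdot>\<^sub>m X + X') * Y) = c * mtrace (E X * Y) + mtrace (E X' * Y)"
    using EX Y by (simp add: mtrace_linear[of _ d])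
qed (use that in blast)

section \<open>The Schwarz inequality for the dual of a CPTP map\<close>

text \<open>With F = (1, \<open>adj Z\<close>) the two off-diagonal blocks of the twofold
  amplification are \<open>E (A * Z)\<close> and \<open>E (adj Z * A)\<close>, hence adjoint to each
  other.\<close>

lemma completely_positive_adj:
  assumes E: "Defs.linear_map d E" "completely_positive d E"
    and A: "A \<in> carrier_mat d d" "psd A" and Z: "Z \<in> carrier_mat d d"
  shows "adj (E (A * Z)) = E (adj Z * A)"
  using completely_positive_trace(2)[OF E A, of 2 "\<lambda>a. if a = 0 then 1\<^sub>m d else adj Z" "\<lambda>a. 1\<^sub>m d" 0 1] A Z
  by (simp add: square_mat_algebra[where n = d])

text \<open>With \<open>X = [1; Z\<^sup>*] A [1, Z]\<close> and \<open>C = [Y; -1]\<close>, the inequality is \<open>tr(C\<^sup>* (E \<otimes> id\<^sub>2)(X) C) \<ge> 0\<close>.\<close>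

lemma CPTP_schwarz:
  assumes E: "CPTP d E"
    and A: "A \<in> carrier_mat d d" "psd A" and Z: "Z \<in> carrier_mat d d" and Y: "Y \<in> carrier_mat d d"
    and dual: "mtrace (E (adj Z * A) * Y) = mtrace (adj Z * A * Z)"
  shows "Re (mtrace (adj Z * A * Z)) \<le> Re (mtrace (adj Y * E A * Y))"
proof -
  have E': "Defs.linear_map d E" "completely_positive d E" and tp: "trace_preserving d E"
    using E by (auto simp: CPTP_def)
  have Ec: "E X \<in> carrier_mat d d" if "X \<in> carrier_mat d d" for X
    using E'(1) that by (auto simp: Defs.linear_map_def)
  define C where "C a = (if a = 0 then Y else - 1\<^sub>m d)" for a :: nat
  define F where "F a = (if a = 0 then 1\<^sub>m d else adj Z)" for a :: nat
  have adj_neg: "adj (- 1\<^sub>m d) = - 1\<^sub>m d" by (intro eq_matI) auto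
  have neg_l: "- 1\<^sub>m d * X = - X" and neg_r: "X * - 1\<^sub>m d = - X"
    if "X \<in> carrier_mat d d" for X :: "complex mat"
    using that by (simp_all add: uminus_mult_left_mat uminus_mult_right_mat)
  have neg_mult: "adj Y * - X = - (adj Y * X)" "- X * Y = - (X * Y)"
    if "X \<in> carrier_mat d d" for X
    using that Y by (simp_all add: uminus_mult_left_mat uminus_mult_right_mat)
  have tr_neg: "mtrace (- X) = - mtrace X" if "X \<in> carrier_mat d d" for X
    using that by (simp add: mtrace_def sum_negf)
  note alg = square_mat_algebra[where n = d]
  have "0 \<le> Re (\<Sum>a<2. \<Sum>b<2. mtrace (adj (C a) * E (F a * A * adj (F b)) * C b))"
    using Y Z by (intro completely_positive_trace(1)[OF E' A]) (auto simp: C_def F_def)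
  also have "(\<Sum>a<2. \<Sum>b<2. mtrace (adj (C a) * E (F a * A * adj (F b)) * C b))
    = mtrace (adj Y * E A * Y) - mtrace (adj Y * E (A * Z)) - mtrace (E (adj Z * A) * Y)
      + mtrace (E (adj Z * A * Z))"
    using A Z Y Ec by (simp add: numeral_2_eq_2 C_def F_def adj_neg neg_l neg_r neg_mult tr_neg alg)
  \<comment> \<open>The cross terms are complex conjugates, so by \<open>dual\<close> they
    contribute -2 Re tr(\<open>adj Z * A * Z\<close>). Trace preservation turns the last term into
    one positive copy, leaving a net coefficient of -1.\<close>
  also have "mtrace (adj Y * E (A * Z)) = cnj (mtrace (E (adj Z * A) * Y))"
    using mtrace_adj[of "adj Y * E (A * Z)" d] A Z Y Ec
    by (simp add: alg completely_positive_adj[OF E' A Z])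
  also have "mtrace (E (adj Z * A * Z)) = mtrace (adj Z * A * Z)"
    using tp A Z by (simp add: trace_preserving_def alg)
  finally show ?thesis by (simp add: dual)
qed

text \<open>A single Z, fixed before A, has to serve both quadratic terms of the variational
  formula. The first bound is the Schwarz inequality for (Z, Y), the second the one for
  (\<open>adj Z\<close>, \<open>adj Y\<close>).\<close>

lemma CPTP_dual_schwarz:
  assumes E: "CPTP d E" and Y: "Y \<in> carrier_mat d d"
  obtains Z where "Z \<in> carrier_mat d d"
    "\<And>W. W \<in> carrier_mat d d \<Longrightarrow> mtrace (E W * Y) = mtrace (W * Z)"
    "\<And>A. A \<in> carrier_mat d d \<Longrightarrow> psd A \<Longrightarrow> Re (mtrace (adj Z * A * Z)) \<le> Re (mtrace (adj Y * E A * Y))"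
    "\<And>A. A \<in> carrier_mat d d \<Longrightarrow> psd A \<Longrightarrow> Re (mtrace (Z * A * adj Z)) \<le> Re (mtrace (Y * E A * adj Y))"
proof -
  have E': "Defs.linear_map d E" "completely_positive d E"
    using E by (auto simp: CPTP_def)
  have Ec: "E X \<in> carrier_mat d d" if "X \<in> carrier_mat d d" for X
    using E'(1) that by (auto simp: Defs.linear_map_def)
  note alg = square_mat_algebra[where n = d]
  obtain Z where Z: "Z \<in> carrier_mat d d"
    and dual: "\<And>W. W \<in> carrier_mat d d \<Longrightarrow> mtrace (E W * Y) = mtrace (W * Z)"
    using dual_matrix[OF E'(1) Y] by blast
  show ?thesis
  proof (rule that[OF Z dual])
    fix A assume A: "A \<in> carrier_mat d d" "psd A"
    show "Re (mtrace (adj Z * A * Z)) \<le> Re (mtrace (adj Y * E A * Y))"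
      by (rule CPTP_schwarz[OF E A Z Y dual]) (use A Z in \<open>simp add: alg\<close>)
    have hA: "adj A = A" using A psd_iff by auto
    \<comment> \<open>This chain verifies the duality condition for the pair (\<open>adj Z\<close>,
      \<open>adj Y\<close>), by taking adjoints on both sides of the known duality for (Z,
      Y).\<close>
    have "mtrace (E (Z * A) * adj Y) = mtrace (adj (Y * E (A * adj Z)))"
      using completely_positive_adj[OF E' A, of "adj Z"] A Z Y Ec by (simp add: alg)
    also have "\<dots> = cnj (mtrace (E (A * adj Z) * Y))"
      using A Z Y Ec mtrace_mult_commute[of Y d d "E (A * adj Z)"]
      by (subst mtrace_adj[of _ d]) (simp_all add: alg)
    also have "\<dots> = mtrace (adj (A * adj Z * Z))"
      using A Z by (subst mtrace_adj[of _ d]) (simp_all add: dual alg)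
    also have "\<dots> = mtrace ((adj Z * Z) * A)"
      using A Z hA by (simp add: alg)
    also have "\<dots> = mtrace (Z * A * adj Z)"
      using A Z mtrace_mult_commute[of "adj Z" d d "Z * A"] by (simp add: alg)
    finally show "Re (mtrace (Z * A * adj Z)) \<le> Re (mtrace (Y * E A * adj Y))"
      using CPTP_schwarz[OF E A, of "adj Z" "adj Y"] Z Y by simp
  qed
qed

lemma CPTP_density:
  assumes E: "CPTP d E" and \<rho>: "density d \<rho>"
  shows "density d (E \<rho>)"
proof -
  have \<rho>': "\<rho> \<in> carrier_mat d d" "psd \<rho>" "mtrace \<rho> = 1" using \<rho> by (auto simp: density_def)
  have Ec: "E \<rho> \<in> carrier_mat d d" using E \<rho>' by (auto simp: CPTP_def Defs.linear_map_def)
  \<comment> \<open>Positivity of E is the case k = 1 of complete positivity, where the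
    amplification is E itself.\<close>
  have "block d \<rho> 0 0 = \<rho>" using \<rho>' by (intro eq_matI) (auto simp: block_def)
  then have "ampl d 1 E \<rho> = E \<rho>" using Ec by (intro eq_matI) (auto simp: ampl_def)
  then have "psd (E \<rho>)" using E \<rho>' by (auto simp: CPTP_def completely_positive_def dest!: spec[of _ "1::nat"])
  then show ?thesis using E \<rho>' Ec by (simp add: density_def CPTP_def trace_preserving_def)
qed

section \<open>Traces in a pair of eigenbases\<close>

lemma mtrace_unitary_conj:
  assumes "unitary n U" "X \<in> carrier_mat n n"
  shows "mtrace (U * X * adj U) = mtrace X"
  using mtrace_mult_commute[of "U * X" n n "adj U"] unitaryD[OF assms(1)] assms(2)
    square_mat_algebra(3)[of "adj U" n U X]
  by simp

lemma mtrace_mat_diag: "mtrace (mat_diag n f) = (\<Sum>i<n. f i)"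
  by (simp add: mtrace_def mat_diag_def)

text \<open>\<open>mat_fun\<close> is a choice, so the lemma returns the very decomposition that
  witnesses the chosen value; U and lam are obtained together with f.\<close>

lemma mat_fun_spectral:
  assumes "A \<in> carrier_mat n n" "adj A = A"
  obtains U and lam :: "nat \<Rightarrow> real" where "unitary n U"
    "A = U * mat_diag n (\<lambda>i. complex_of_real (lam i)) * adj U"
    "mat_fun f A = U * mat_diag n (\<lambda>i. complex_of_real (f (lam i))) * adj U"
proof -
  define P where "P B \<longleftrightarrow> (\<exists>U (lam :: nat \<Rightarrow> real). unitary n U \<and>
      A = U * mat_diag n (\<lambda>i. complex_of_real (lam i)) * adj U \<and>
      B = U * mat_diag n (\<lambda>i. complex_of_real (f (lam i))) * adj U)" for B
  have dim: "dim_row A = n" using assms by simp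
  have "\<exists>B. P B" using spectral_theorem[OF assms] unfolding P_def by blast
  then have "P (SOME B. P B)" by (rule someI_ex)
  moreover have "(SOME B. P B) = mat_fun f A" unfolding mat_fun_def P_def dim ..
  ultimately have "P (mat_fun f A)" by simp
  then show ?thesis using that unfolding P_def by blast
qed

lemma eigenvalue_eq:
  assumes "unitary n U" "k < n"
  shows "(adj U * (U * mat_diag n f * adj U) * U) $$ (k, k) = f k"
proof -
  note U = unitaryD[OF assms(1)]
  have "adj U * (U * mat_diag n f * adj U) * U = (adj U * U) * mat_diag n f * (adj U * U)"
    using U(1) by (simp add: square_mat_algebra[where n = n])
  then show ?thesis using U assms(2) by (simp add: mat_diag_def)
qed

text \<open>Multiplied by s, the gap between the two sides is the squared modulus of s z - a w.
  Equality therefore holds at z = (a / s) w, the point used in the next lemma.\<close>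

lemma complete_square_le:
  fixes w z :: complex and a s :: real
  assumes "0 < s"
  shows "2 * a * Re (z * cnj w) - s * (cmod z)\<^sup>2 \<le> (cmod w)\<^sup>2 * a\<^sup>2 / s"
proof -
  have "0 \<le> (s * Re z - a * Re w)\<^sup>2 + (s * Im z - a * Im w)\<^sup>2" by simp
  also have "\<dots> = s * ((cmod w)\<^sup>2 * a\<^sup>2 / s - (2 * a * Re (z * cnj w) - s * (cmod z)\<^sup>2))"
    using assms unfolding cmod_power2 by (simp add: field_simps power2_eq_square)
  finally show ?thesis using assms by (simp add: zero_le_mult_iff)
qed

lemma complete_square_eq:
  fixes w :: complex and a s :: real
  assumes "0 < s"
  shows "2 * a * Re (complex_of_real (a / s) * w * cnj w) - s * (cmod (complex_of_real (a / s) * w))\<^sup>2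
    = (cmod w)\<^sup>2 * a\<^sup>2 / s"
proof -
  have "Re (complex_of_real (a / s) * w * cnj w) = a / s * (cmod w)\<^sup>2"
    unfolding cmod_power2 by (simp add: power2_eq_square field_simps)
  moreover have "(cmod (complex_of_real (a / s) * w))\<^sup>2 = (a / s)\<^sup>2 * (cmod w)\<^sup>2"
    by (simp add: norm_mult norm_divide power_mult_distrib power_divide)
  ultimately show ?thesis using assms by (simp add: field_simps power2_eq_square)
qed

text \<open>Fixes one eigenbasis for each of two Hermitian matrices. It is interpreted once before
  and once after the action of E, with the same V and mu, since \<sigma> is a fixed point.\<close>

locale spectral_pair =
  fixes n :: nat and U V :: "complex mat" and lam mu :: "nat \<Rightarrow> real"
  assumes U: "unitary n U" and V: "unitary n V"
begin

definition \<rho> where "\<rho> = U * mat_diag n (\<lambda>i. complex_of_real (lam i)) * adj U"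
definition \<sigma> where "\<sigma> = V * mat_diag n (\<lambda>i. complex_of_real (mu i)) * adj V"
text \<open>The transition probability between the i-th column of U and the j-th column of
  V.\<close>

definition overlap where "overlap i j = (cmod ((adj U * V) $$ (i, j)))\<^sup>2"

lemmas alg = square_mat_algebra[where n = n]

lemma carriers: "U \<in> carrier_mat n n" "V \<in> carrier_mat n n" "\<rho> \<in> carrier_mat n n" "\<sigma> \<in> carrier_mat n n"
  "adj U * V \<in> carrier_mat n n"
  using unitaryD(1)[OF U] unitaryD(1)[OF V] by (auto simp: \<rho>_def \<sigma>_def alg)

text \<open>Once products are right-associated, a unitary meets its adjoint only in front of a
  further factor; these forms let the simplifier cancel the pair there.\<close>

lemma unitary_cancel:
  assumes "X \<in> carrier_mat n n"
  shows "adj U * (U * X) = X" "adj V * (V * X) = X" "U * (adj U * X) = X" "V * (adj V * X) = X"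
  using assms unitaryD[OF U] unitaryD[OF V]
    square_mat_algebra(3)[of "adj U" n U X] square_mat_algebra(3)[of "adj V" n V X]
    square_mat_algebra(3)[of U n "adj U" X] square_mat_algebra(3)[of V n "adj V" X]
  by simp_all

text \<open>In \<open>U * z * adj V\<close> the matrix z holds mixed coordinates: rows refer to the
  eigenbasis U of \<rho>, columns to the eigenbasis V of \<sigma>. In these coordinates this trace
  and the two below decouple over the pairs (i, j).\<close>

lemma mtrace_rho_mult:
  assumes z: "z \<in> carrier_mat n n"
  shows "mtrace (\<rho> * (U * z * adj V))
    = (\<Sum>i<n. \<Sum>j<n. complex_of_real (lam i) * (z $$ (i, j) * cnj ((adj U * V) $$ (i, j))))"
proof -
  let ?D = "mat_diag n (\<lambda>i. complex_of_real (lam i))"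
  have "\<rho> * (U * z * adj V) = U * (?D * z * adj (adj U * V)) * adj U"
    using z carriers by (simp add: \<rho>_def alg unitary_cancel unitaryD(3)[OF U])
  then have "mtrace (\<rho> * (U * z * adj V)) = mtrace (?D * z * adj (adj U * V))"
    using mtrace_unitary_conj[OF U, of "?D * z * adj (adj U * V)"] z carriers by (simp add: alg)
  also have "\<dots> = (\<Sum>i<n. \<Sum>j<n. (?D * z) $$ (i, j) * adj (adj U * V) $$ (j, i))"
    using z carriers by (intro mtrace_mult) (auto simp: alg)
  also have "\<dots> = (\<Sum>i<n. \<Sum>j<n. complex_of_real (lam i) * (z $$ (i, j) * cnj ((adj U * V) $$ (i, j))))"
    using z carriers
    by (auto simp: mat_diag_mult_left[OF z] mult.assoc intro!: sum.cong simp del: index_mult_mat(1))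
  finally show ?thesis .
qed

lemma mtrace_rho_sandwich:
  assumes z: "z \<in> carrier_mat n n"
  shows "mtrace (adj (U * z * adj V) * \<rho> * (U * z * adj V))
    = (\<Sum>i<n. \<Sum>j<n. complex_of_real (lam i * (cmod (z $$ (i, j)))\<^sup>2))"
proof -
  let ?D = "mat_diag n (\<lambda>i. complex_of_real (lam i))"
  have "adj (U * z * adj V) * \<rho> * (U * z * adj V) = V * (adj z * (?D * z)) * adj V"
    using z carriers by (simp add: \<rho>_def alg unitary_cancel)
  then have "mtrace (adj (U * z * adj V) * \<rho> * (U * z * adj V)) = mtrace (adj z * (?D * z))"
    using mtrace_unitary_conj[OF V, of "adj z * (?D * z)"] z by (simp add: alg)
  also have "\<dots> = (\<Sum>j<n. \<Sum>i<n. adj z $$ (j, i) * (?D * z) $$ (i, j))"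
    using z by (intro mtrace_mult) (auto simp: alg)
  also have "\<dots> = (\<Sum>j<n. \<Sum>i<n. complex_of_real (lam i * (cmod (z $$ (i, j)))\<^sup>2))"
    using z by (auto simp: mat_diag_mult_left[OF z] complex_norm_square mult.commute mult.left_commute
        intro!: sum.cong simp del: index_mult_mat(1) of_real_power)
  finally show ?thesis by (subst sum.swap)
qed

lemma mtrace_sigma_sandwich:
  assumes z: "z \<in> carrier_mat n n"
  shows "mtrace ((U * z * adj V) * \<sigma> * adj (U * z * adj V))
    = (\<Sum>i<n. \<Sum>j<n. complex_of_real (mu j * (cmod (z $$ (i, j)))\<^sup>2))"
proof -
  let ?D = "mat_diag n (\<lambda>i. complex_of_real (mu i))"
  have "(U * z * adj V) * \<sigma> * adj (U * z * adj V) = U * ((z * ?D) * adj z) * adj U"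
    using z carriers by (simp add: \<sigma>_def alg unitary_cancel)
  then have "mtrace ((U * z * adj V) * \<sigma> * adj (U * z * adj V)) = mtrace ((z * ?D) * adj z)"
    using mtrace_unitary_conj[OF U, of "(z * ?D) * adj z"] z by (simp add: alg)
  also have "\<dots> = (\<Sum>i<n. \<Sum>j<n. (z * ?D) $$ (i, j) * adj z $$ (j, i))"
    using z by (intro mtrace_mult) (auto simp: alg)
  also have "\<dots> = (\<Sum>i<n. \<Sum>j<n. complex_of_real (mu j * (cmod (z $$ (i, j)))\<^sup>2))"
    using z by (auto simp: mat_diag_mult_right[OF z] complex_norm_square mult.commute mult.left_commute
        intro!: sum.cong simp del: index_mult_mat(1) of_real_power)
  finally show ?thesis .
qed

text \<open>For t \<ge> 0, nonnegative lam and positive mu, its supremum over Z is the quadratic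
  form at \<rho> of the inverse of the map X -> t \<rho> X + X \<sigma>, hence the name.\<close>

definition resolvent_form where
  "resolvent_form t Z = 2 * Re (mtrace (\<rho> * Z)) - t * Re (mtrace (adj Z * \<rho> * Z)) - Re (mtrace (Z * \<sigma> * adj Z))"

lemma resolvent_form_eq:
  assumes z: "z \<in> carrier_mat n n"
  shows "resolvent_form t (U * z * adj V) = (\<Sum>i<n. \<Sum>j<n.
    2 * lam i * Re (z $$ (i, j) * cnj ((adj U * V) $$ (i, j))) - (t * lam i + mu j) * (cmod (z $$ (i, j)))\<^sup>2)"
proof -
  have 1: "Re (mtrace (\<rho> * (U * z * adj V)))
    = (\<Sum>i<n. \<Sum>j<n. lam i * Re (z $$ (i, j) * cnj ((adj U * V) $$ (i, j))))"
  proof -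
    have "Re (complex_of_real r * w) = r * Re w" for r w by simp
    then show ?thesis
      by (simp add: mtrace_rho_mult[OF z] del: times_complex.sel index_mult_mat(1))
  qed
  have 2: "Re (mtrace (adj (U * z * adj V) * \<rho> * (U * z * adj V)))
    = (\<Sum>i<n. \<Sum>j<n. lam i * (cmod (z $$ (i, j)))\<^sup>2)"
    by (simp add: mtrace_rho_sandwich[OF z] flip: of_real_sum)
  have 3: "Re (mtrace ((U * z * adj V) * \<sigma> * adj (U * z * adj V)))
    = (\<Sum>i<n. \<Sum>j<n. mu j * (cmod (z $$ (i, j)))\<^sup>2)"
    by (simp add: mtrace_sigma_sandwich[OF z] flip: of_real_sum)
  show ?thesis unfolding resolvent_form_def 1 2 3
    by (simp add: sum_distrib_left sum_subtractf[symmetric] algebra_simps del: times_complex.sel index_mult_mat(1))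
qed

text \<open>Passing to mixed coordinates leaves one independent complex square for each pair (i, j),
  to be completed with s = \<open>t * lam i + mu j\<close>.\<close>

lemma resolvent_form_le:
  assumes "\<And>i. i < n \<Longrightarrow> 0 \<le> lam i" "\<And>j. j < n \<Longrightarrow> 0 < mu j" "0 \<le> t" and Z: "Z \<in> carrier_mat n n"
  shows "resolvent_form t Z \<le> (\<Sum>i<n. \<Sum>j<n. overlap i j * (lam i)\<^sup>2 / (t * lam i + mu j))"
proof -
  define z where "z = adj U * Z * V"
  have z: "z \<in> carrier_mat n n" using Z carriers by (simp add: z_def alg)
  have "Z = U * z * adj V" using Z carriers by (simp add: z_def alg unitary_cancel unitaryD(3)[OF V])
  then show ?thesis
    unfolding overlap_def
    by (simp only: resolvent_form_eq[OF z])
      (intro sum_mono complete_square_le add_nonneg_pos mult_nonneg_nonneg assms, auto)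
qed

lemma resolvent_form_attained:
  assumes "\<And>i. i < n \<Longrightarrow> 0 \<le> lam i" "\<And>j. j < n \<Longrightarrow> 0 < mu j" "0 \<le> t"
  obtains Z where "Z \<in> carrier_mat n n"
    "resolvent_form t Z = (\<Sum>i<n. \<Sum>j<n. overlap i j * (lam i)\<^sup>2 / (t * lam i + mu j))"
proof -
  \<comment> \<open>Each entry is the maximiser (a / s) w of its own square.\<close>
  define z where "z = mat n n (\<lambda>(i, j). complex_of_real (lam i / (t * lam i + mu j)) * (adj U * V) $$ (i, j))"
  have z: "z \<in> carrier_mat n n" by (simp add: z_def)
  have zi: "z $$ (i, j) = complex_of_real (lam i / (t * lam i + mu j)) * (adj U * V) $$ (i, j)" if "i < n" "j < n" for i j
    using that by (simp add: z_def)
  have pos: "0 < t * lam i + mu j" if "i < n" "j < n" for i j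
    using assms that by (simp add: add_nonneg_pos)
  have "resolvent_form t (U * z * adj V) = (\<Sum>i<n. \<Sum>j<n. overlap i j * (lam i)\<^sup>2 / (t * lam i + mu j))"
    unfolding resolvent_form_eq[OF z] overlap_def
    by (intro sum.cong refl) (simp only: lessThan_iff zi complete_square_eq[OF pos])
  moreover have "U * z * adj V \<in> carrier_mat n n" using z carriers by (simp add: alg)
  ultimately show ?thesis using that by blast
qed

text \<open>The rows of the unitary \<open>adj U * V\<close> have norm 1. This collapses double sums
  whose terms depend on i apart from the overlap.\<close>

lemma sum_overlap: "i < n \<Longrightarrow> (\<Sum>j<n. overlap i j) = 1"
proof -
  assume i: "i < n"
  let ?W = "adj U * V"
  have "?W * adj ?W = 1\<^sub>m n"
    using carriers unitaryD(2)[OF U] by (simp add: alg unitary_cancel)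
  moreover have "(?W * adj ?W) $$ (i, i) = (\<Sum>j<n. ?W $$ (i, j) * adj ?W $$ (j, i))"
    using i carriers by (intro mat_mult_index_sum) auto
  moreover have "\<dots> = complex_of_real (\<Sum>j<n. overlap i j)"
    using i carriers by (auto simp: overlap_def complex_norm_square intro!: sum.cong
        simp del: index_mult_mat(1) of_real_power)
  ultimately have "complex_of_real (\<Sum>j<n. overlap i j) = 1" using i by simp
  then show ?thesis by (simp only: of_real_eq_1_iff)
qed

text \<open>Later \<open>f j\<close> is \<open>ln (mu j)\<close>, which expresses
  \<open>tr_ln\<close> in the same double sums as the resolvent form.\<close>

lemma mtrace_rho_sigma_fun:
  "Re (mtrace (\<rho> * (V * mat_diag n (\<lambda>i. complex_of_real (f i)) * adj V)))
    = (\<Sum>i<n. \<Sum>j<n. overlap i j * (lam i * f j))"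
proof -
  let ?D = "mat_diag n (\<lambda>i. complex_of_real (f i))"
  define z where "z = adj U * V * ?D"
  have z: "z \<in> carrier_mat n n" using carriers by (simp add: z_def alg)
  have "V * ?D * adj V = U * z * adj V"
    using carriers by (simp add: z_def alg unitary_cancel)
  then have "mtrace (\<rho> * (V * ?D * adj V))
    = (\<Sum>i<n. \<Sum>j<n. complex_of_real (lam i) * (z $$ (i, j) * cnj ((adj U * V) $$ (i, j))))"
    by (simp only: mtrace_rho_mult[OF z])
  also have "\<dots> = (\<Sum>i<n. \<Sum>j<n. complex_of_real (overlap i j * (lam i * f j)))"
    using carriers by (auto simp: z_def mat_diag_mult_right[of _ n] overlap_def complex_norm_square
        intro!: sum.cong simp del: index_mult_mat(1) of_real_power)
  finally show ?thesis by (simp flip: of_real_sum)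
qed

end

section \<open>Monotonicity of the relative entropy\<close>

text \<open>The k-th eigenvalue is the quadratic form at the k-th column of U.\<close>

lemma psd_eigenvalues_nonneg:
  assumes "unitary n U" "psd (U * mat_diag n (\<lambda>i. complex_of_real (lam i)) * adj U)" "k < n"
  shows "0 \<le> lam k"
proof -
  have "U * mat_diag n (\<lambda>i. complex_of_real (lam i)) * adj U \<in> carrier_mat n n"
    using unitaryD(1)[OF assms(1)] by (simp add: square_mat_algebra[where n = n])
  from psd_diag_entry[OF this assms(2) unitaryD(1)[OF assms(1)] assms(3)] show ?thesis
    unfolding eigenvalue_eq[OF assms(1,3)] by simp
qed

lemma pos_def_eigenvalues_pos:
  assumes "unitary n U" "pos_def (U * mat_diag n (\<lambda>i. complex_of_real (lam i)) * adj U)" "k < n"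
  shows "0 < lam k"
proof -
  have "U * mat_diag n (\<lambda>i. complex_of_real (lam i)) * adj U \<in> carrier_mat n n"
    using unitaryD(1)[OF assms(1)] by (simp add: square_mat_algebra[where n = n])
  from pos_def_diag_entry[OF this assms(2,1,3)] show ?thesis
    unfolding eigenvalue_eq[OF assms(1,3)] by simp
qed

text \<open>A zero eigenvalue contributes \<open>0 * ln 0\<close>, which evaluates to 0 as the
  entropy convention requires.\<close>

lemma vn_entropy_spectral:
  assumes "density n \<rho>"
  obtains U lam where "unitary n U" "\<rho> = U * mat_diag n (\<lambda>i. complex_of_real (lam i)) * adj U"
    "vn_entropy \<rho> = - (\<Sum>i<n. lam i * ln (lam i))" "\<And>i. i < n \<Longrightarrow> 0 \<le> lam i" "(\<Sum>i<n. lam i) = 1"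
proof -
  have \<rho>: "\<rho> \<in> carrier_mat n n" "psd \<rho>" "mtrace \<rho> = 1" using assms by (auto simp: density_def)
  then have "adj \<rho> = \<rho>" using psd_iff by blast
  then obtain U lam where U: "unitary n U"
    and eq: "\<rho> = U * mat_diag n (\<lambda>i. complex_of_real (lam i)) * adj U"
    and f: "mat_fun (\<lambda>x. x * ln x) \<rho> = U * mat_diag n (\<lambda>i. complex_of_real (lam i * ln (lam i))) * adj U"
    by (rule mat_fun_spectral[OF \<rho>(1)])
  have "vn_entropy \<rho> = - (\<Sum>i<n. lam i * ln (lam i))"
    unfolding vn_entropy_def f mtrace_unitary_conj[OF U mat_diag_dim] mtrace_mat_diag by simp
  moreover have "complex_of_real (\<Sum>i<n. lam i) = 1"
    using \<rho>(3) unfolding eq mtrace_unitary_conj[OF U mat_diag_dim] mtrace_mat_diag by simp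
  then have "(\<Sum>i<n. lam i) = 1" by (simp only: of_real_eq_1_iff)
  moreover have "0 \<le> lam i" if "i < n" for i
    using psd_eigenvalues_nonneg[OF U _ that] \<rho>(2) eq by simp
  ultimately show ?thesis using that U eq by blast
qed

text \<open>Each side is minus a relative entropy to \<sigma>. The resolvent comparison for every t
  \<ge> 0 is fed into \<open>weighted_log_ratio_mono\<close>, with pairs (i, j) as indices, overlaps
  as weights, a = \<open>lam i\<close> and b = \<open>mu j\<close>.\<close>

theorem relative_entropy_mono:
  assumes E: "CPTP d E" and \<rho>: "density d \<rho>" and \<sigma>: "density d \<sigma>" "pos_def \<sigma>" and fixed: "E \<sigma> = \<sigma>"
  shows "vn_entropy \<rho> + tr_ln \<rho> \<sigma> \<le> vn_entropy (E \<rho>) + tr_ln (E \<rho>) \<sigma>"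
proof -
  have \<rho>c: "\<rho> \<in> carrier_mat d d" "psd \<rho>" and \<sigma>c: "\<sigma> \<in> carrier_mat d d" "psd \<sigma>"
    using \<rho> \<sigma> by (auto simp: density_def)
  have "adj \<sigma> = \<sigma>" using \<sigma>c psd_iff by blast
  then obtain V mu where V: "unitary d V"
    and \<sigma>_eq: "\<sigma> = V * mat_diag d (\<lambda>i. complex_of_real (mu i)) * adj V"
    and ln_eq: "mat_ln \<sigma> = V * mat_diag d (\<lambda>i. complex_of_real (ln (mu i))) * adj V"
    unfolding mat_ln_def by (rule mat_fun_spectral[OF \<sigma>c(1)])
  have mu: "0 < mu j" if "j < d" for j
    using pos_def_eigenvalues_pos[OF V _ that] \<sigma>(2) \<sigma>_eq by simp
  obtain U lam where U: "unitary d U" and \<rho>_eq: "\<rho> = U * mat_diag d (\<lambda>i. complex_of_real (lam i)) * adj U"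
    and S: "vn_entropy \<rho> = - (\<Sum>i<d. lam i * ln (lam i))"
    and lam: "\<And>i. i < d \<Longrightarrow> 0 \<le> lam i" "(\<Sum>i<d. lam i) = 1"
    using vn_entropy_spectral[OF \<rho>] by blast
  obtain U' lam' where U': "unitary d U'" and \<rho>'_eq: "E \<rho> = U' * mat_diag d (\<lambda>i. complex_of_real (lam' i)) * adj U'"
    and S': "vn_entropy (E \<rho>) = - (\<Sum>i<d. lam' i * ln (lam' i))"
    and lam': "\<And>i. i < d \<Longrightarrow> 0 \<le> lam' i" "(\<Sum>i<d. lam' i) = 1"
    using vn_entropy_spectral[OF CPTP_density[OF E \<rho>]] by blast
  interpret p: spectral_pair d U V lam mu by standard (rule U V)+
  interpret p': spectral_pair d U' V lam' mu by standard (rule U' V)+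
  have p\<rho>: "p.\<rho> = \<rho>" "p.\<sigma> = \<sigma>" "p'.\<rho> = E \<rho>" "p'.\<sigma> = \<sigma>"
    by (simp_all add: p.\<rho>_def p.\<sigma>_def p'.\<rho>_def p'.\<sigma>_def \<rho>_eq[symmetric] \<sigma>_eq[symmetric] \<rho>'_eq[symmetric])
  have res: "(\<Sum>i<d. \<Sum>j<d. p'.overlap i j * (lam' i)\<^sup>2 / (t * lam' i + mu j))
    \<le> (\<Sum>i<d. \<Sum>j<d. p.overlap i j * (lam i)\<^sup>2 / (t * lam i + mu j))" if t: "0 \<le> t" for t
  proof -
    \<comment> \<open>Y is optimal after the action of E; its dual image Z is merely a competitor
      before it, which gives the inequality in the required direction.\<close>
    obtain Y where Y: "Y \<in> carrier_mat d d"
      and Y_eq: "p'.resolvent_form t Y = (\<Sum>i<d. \<Sum>j<d. p'.overlap i j * (lam' i)\<^sup>2 / (t * lam' i + mu j))"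
      by (rule p'.resolvent_form_attained[OF lam'(1) mu t])
    obtain Z where Z: "Z \<in> carrier_mat d d"
      and dual: "\<And>W. W \<in> carrier_mat d d \<Longrightarrow> mtrace (E W * Y) = mtrace (W * Z)"
      and schwarz: "\<And>A. A \<in> carrier_mat d d \<Longrightarrow> psd A \<Longrightarrow> Re (mtrace (adj Z * A * Z)) \<le> Re (mtrace (adj Y * E A * Y))"
        "\<And>A. A \<in> carrier_mat d d \<Longrightarrow> psd A \<Longrightarrow> Re (mtrace (Z * A * adj Z)) \<le> Re (mtrace (Y * E A * adj Y))"
      using CPTP_dual_schwarz[OF E Y] by blast
    \<comment> \<open>The linear terms agree by duality, and the two Schwarz bounds compare the
      quadratic ones. The fixed point enters in the last term, where \<open>E \<sigma>\<close> is
      replaced by \<sigma>.\<close>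
    have "p'.resolvent_form t Y \<le> p.resolvent_form t Z"
      unfolding p.resolvent_form_def p'.resolvent_form_def p\<rho>
      using dual[OF \<rho>c(1)] mult_left_mono[OF schwarz(1)[OF \<rho>c] t] schwarz(2)[OF \<sigma>c] fixed by simp
    also have "\<dots> \<le> (\<Sum>i<d. \<Sum>j<d. p.overlap i j * (lam i)\<^sup>2 / (t * lam i + mu j))"
      by (rule p.resolvent_form_le[OF lam(1) mu t Z])
    finally show ?thesis by (simp add: Y_eq)
  qed
  let ?I = "{..<d} \<times> {..<d}"
  have "(\<Sum>(i, j)\<in>?I. p'.overlap i j * (lam' i * ln (lam' i) - lam' i * ln (mu j)))
    \<le> (\<Sum>(i, j)\<in>?I. p.overlap i j * (lam i * ln (lam i) - lam i * ln (mu j)))"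
    unfolding case_prod_unfold
  proof (rule weighted_log_ratio_mono)
    \<comment> \<open>Summing the overlaps over j leaves the traces of \<rho> and
      \<open>E \<rho>\<close>, both equal to 1.\<close>
    show "(\<Sum>x\<in>?I. p.overlap (fst x) (snd x) * lam (fst x)) = (\<Sum>x\<in>?I. p'.overlap (fst x) (snd x) * lam' (fst x))"
      using lam(2) lam'(2) p.sum_overlap p'.sum_overlap
      by (simp add: sum.cartesian_product' flip: sum_distrib_right)
    show "(\<Sum>x\<in>?I. p'.overlap (fst x) (snd x) * (lam' (fst x))\<^sup>2 / (t * lam' (fst x) + mu (snd x)))
      \<le> (\<Sum>x\<in>?I. p.overlap (fst x) (snd x) * (lam (fst x))\<^sup>2 / (t * lam (fst x) + mu (snd x)))"
      if "0 \<le> t" for t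
      using res[OF that] by (simp add: sum.cartesian_product')
  qed (use lam lam' mu in auto)
  moreover have "(\<Sum>(i, j)\<in>?I. p.overlap i j * (lam i * ln (lam i) - lam i * ln (mu j)))
    = - vn_entropy \<rho> - tr_ln \<rho> \<sigma>"
  proof -
    have "tr_ln \<rho> \<sigma> = (\<Sum>i<d. \<Sum>j<d. p.overlap i j * (lam i * ln (mu j)))"
      unfolding tr_ln_def ln_eq by (rule p.mtrace_rho_sigma_fun[unfolded p\<rho>])
    moreover have "(\<Sum>i<d. \<Sum>j<d. p.overlap i j * (lam i * ln (lam i))) = - vn_entropy \<rho>"
      by (simp add: S p.sum_overlap flip: sum_distrib_right)
    ultimately show ?thesis
      by (simp add: right_diff_distrib sum_subtractf flip: sum.cartesian_product)
  qed
  moreover have "(\<Sum>(i, j)\<in>?I. p'.overlap i j * (lam' i * ln (lam' i) - lam' i * ln (mu j)))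
    = - vn_entropy (E \<rho>) - tr_ln (E \<rho>) \<sigma>"
  proof -
    have "tr_ln (E \<rho>) \<sigma> = (\<Sum>i<d. \<Sum>j<d. p'.overlap i j * (lam' i * ln (mu j)))"
      unfolding tr_ln_def ln_eq by (rule p'.mtrace_rho_sigma_fun[unfolded p\<rho>])
    moreover have "(\<Sum>i<d. \<Sum>j<d. p'.overlap i j * (lam' i * ln (lam' i))) = - vn_entropy (E \<rho>)"
      by (simp add: S' p'.sum_overlap flip: sum_distrib_right)
    ultimately show ?thesis
      by (simp add: right_diff_distrib sum_subtractf flip: sum.cartesian_product)
  qed
  ultimately show ?thesis by simp
qed

section \<open>Telescoping before and after the measurement\<close>

text \<open>One use of monotonicity bounds the entropy drop of each step by its summand, and the
  drops telescope. The start index k lets the lemma serve the stage from 0 to m and, for each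
  outcome, the stage from m to N; density is carried along to feed the next step.\<close>

lemma entropy_production_chain:
  fixes k N :: nat
  assumes k: "k \<le> N" and start: "density d (r k)"
    and E: "\<And>n. k + 1 \<le> n \<Longrightarrow> n \<le> N \<Longrightarrow> CPTP d (E n)"
    and ss: "\<And>n. k + 1 \<le> n \<Longrightarrow> n \<le> N \<Longrightarrow> unique_pd_steady_state d (E n) (s n)"
    and step: "\<And>n. k + 1 \<le> n \<Longrightarrow> n \<le> N \<Longrightarrow> r n = E n (r (n - 1))"
  shows "density d (r N) \<and>
    vn_entropy (r k) - vn_entropy (r N) \<le> (\<Sum>n = k + 1..N. tr_ln (r n) (s n) - tr_ln (r (n - 1)) (s n))"
  using k E ss step
proof (induction N rule: dec_induct)
  case base
  then show ?case using start by simp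
next
  case (step N)
  have IH: "density d (r N)"
    "vn_entropy (r k) - vn_entropy (r N) \<le> (\<Sum>n = k + 1..N. tr_ln (r n) (s n) - tr_ln (r (n - 1)) (s n))"
    using step.IH step.prems by auto
  have S: "CPTP d (E (Suc N))" "unique_pd_steady_state d (E (Suc N)) (s (Suc N))" "r (Suc N) = E (Suc N) (r N)"
    using step.hyps step.prems(1-3)[of "Suc N"] by auto
  have "vn_entropy (r N) + tr_ln (r N) (s (Suc N)) \<le> vn_entropy (r (Suc N)) + tr_ln (r (Suc N)) (s (Suc N))"
    unfolding S(3) using S(2)
    by (intro relative_entropy_mono[OF S(1) IH(1)]) (auto simp: unique_pd_steady_state_def)
  then show ?case
    using IH CPTP_density[OF S(1) IH(1)] S(3) step.hyps by simp
qed

theorem theorem6p2: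
  fixes d m N :: nat
    and \<rho>i :: "complex mat"
    and E :: "nat \<Rightarrow> complex mat \<Rightarrow> complex mat"
    and \<rho>ss :: "nat \<Rightarrow> complex mat"
    and \<rho> :: "nat \<Rightarrow> complex mat"
    and B :: "'b set"
    and M :: "'b \<Rightarrow> complex mat"
    and p :: "'b \<Rightarrow> real"
    and Eb :: "'b \<Rightarrow> nat \<Rightarrow> complex mat \<Rightarrow> complex mat"
    and \<rho>ssb :: "'b \<Rightarrow> nat \<Rightarrow> complex mat"
    and \<rho>b :: "'b \<Rightarrow> nat \<Rightarrow> complex mat"
    and I_QC \<sigma>_ex :: real
  assumes dens_i: "density d \<rho>i"
    and mN: "1 \<le> m" "m < N"
    and E_cptp: "\<And>n. 1 \<le> n \<Longrightarrow> n \<le> m \<Longrightarrow> CPTP d (E n)"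
    and E_ss: "\<And>n. 1 \<le> n \<Longrightarrow> n \<le> m \<Longrightarrow> unique_pd_steady_state d (E n) (\<rho>ss n)"
    and rho0: "\<rho> 0 = \<rho>i"
    and rho_step: "\<And>n. 1 \<le> n \<Longrightarrow> n \<le> m \<Longrightarrow> \<rho> n = E n (\<rho> (n - 1))"
    and B_fin: "finite B"
    and M_dim: "\<And>b. b \<in> B \<Longrightarrow> M b \<in> carrier_mat d d"
    and M_complete: "mat d d (\<lambda>(i, j). \<Sum>b\<in>B. (adj (M b) * M b) $$ (i, j)) = 1\<^sub>m d"
    and p_def: "\<And>b. p b = Re (mtrace (adj (M b) * M b * \<rho> m))"
    and I_QC_def: "I_QC = vn_entropy (\<rho> m) - (\<Sum>b\<in>{b\<in>B. p b > 0}. p b * vn_entropy (\<rho>b b m))"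
    and rhob_m: "\<And>b. b \<in> B \<Longrightarrow> p b > 0 \<Longrightarrow>
        \<rho>b b m = complex_of_real (1 / p b) \<cdot>\<^sub>m (M b * \<rho> m * adj (M b))"
    and Eb_cptp: "\<And>b n. b \<in> B \<Longrightarrow> p b > 0 \<Longrightarrow> m + 1 \<le> n \<Longrightarrow> n \<le> N \<Longrightarrow> CPTP d (Eb b n)"
    and Eb_ss: "\<And>b n. b \<in> B \<Longrightarrow> p b > 0 \<Longrightarrow> m + 1 \<le> n \<Longrightarrow> n \<le> N \<Longrightarrow>
        unique_pd_steady_state d (Eb b n) (\<rho>ssb b n)"
    and rhob_step: "\<And>b n. b \<in> B \<Longrightarrow> p b > 0 \<Longrightarrow> m + 1 \<le> n \<Longrightarrow> n \<le> N \<Longrightarrow>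
        \<rho>b b n = Eb b n (\<rho>b b (n - 1))"
    and sigma_def: "\<sigma>_ex =
        (\<Sum>n = 1..m. tr_ln (\<rho> n) (\<rho>ss n) - tr_ln (\<rho> (n - 1)) (\<rho>ss n)) +
        (\<Sum>b\<in>{b\<in>B. p b > 0}. p b *
           (\<Sum>n = m + 1..N. tr_ln (\<rho>b b n) (\<rho>ssb b n) - tr_ln (\<rho>b b (n - 1)) (\<rho>ssb b n)))"
  shows "(\<Sum>b\<in>{b\<in>B. p b > 0}. p b * vn_entropy (\<rho>b b N)) - vn_entropy \<rho>i \<ge> - \<sigma>_ex - I_QC"
proof -
  have 1: "density d (\<rho> m)"
    "vn_entropy \<rho>i - vn_entropy (\<rho> m) \<le> (\<Sum>n = 1..m. tr_ln (\<rho> n) (\<rho>ss n) - tr_ln (\<rho> (n - 1)) (\<rho>ss n))"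
    using entropy_production_chain[of 0 m d \<rho> E \<rho>ss] dens_i E_cptp E_ss rho_step by (auto simp: rho0)
  then have \<rho>m: "\<rho> m \<in> carrier_mat d d" "psd (\<rho> m)" by (auto simp: density_def)
  have dens_b: "density d (\<rho>b b m)" if b: "b \<in> B" "p b > 0" for b
  proof -
    note Mb = M_dim[OF b(1)] and alg = square_mat_algebra[where n = d]
    let ?X = "M b * \<rho> m * adj (M b)"
    have X: "?X \<in> carrier_mat d d" "psd ?X" using Mb \<rho>m psd_sandwich[OF \<rho>m Mb] by (simp_all add: alg)
    have h: "adj ?X = ?X" using X psd_iff by blast
    have c: "\<rho>b b m \<in> carrier_mat d d" using X rhob_m[OF b] by simp
    have tr: "mtrace ?X = mtrace (adj (M b) * M b * \<rho> m)"
      using mtrace_mult_commute[of "M b * \<rho> m" d d "adj (M b)"] Mb \<rho>m by (simp add: alg)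
    \<comment> \<open>The trace is real, so it coincides with \<open>p b\<close>, which is defined
      through a real part.\<close>
    have "cnj (mtrace ?X) = mtrace ?X" using mtrace_adj[OF X(1)] h by simp
    then have "mtrace ?X = complex_of_real (p b)" using tr p_def[of b] by (simp add: complex_eq_iff)
    moreover have "mtrace (\<rho>b b m) = complex_of_real (1 / p b) * mtrace ?X"
      using X(1) unfolding rhob_m[OF b] by (simp add: mtrace_def sum_distrib_left)
    ultimately have tr1: "mtrace (\<rho>b b m) = 1" using b(2) by simp
    have smult_smult: "complex_of_real x \<cdot>\<^sub>m (complex_of_real x \<cdot>\<^sub>m X) = complex_of_real (x * x) \<cdot>\<^sub>m X"
      for x and X :: "complex mat"
      by (intro eq_matI) auto
    \<comment> \<open>The factor 1 / \<open>p b\<close> is split as two square roots, one on each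
      side, so that the normalised state is itself a sandwich of \<open>\<rho> m\<close>.\<close>
    let ?K = "complex_of_real (sqrt (1 / p b)) \<cdot>\<^sub>m M b"
    have K: "?K \<in> carrier_mat d d" using Mb by simp
    have "adj ?K = complex_of_real (sqrt (1 / p b)) \<cdot>\<^sub>m adj (M b)" using Mb by (intro eq_matI) auto
    then have "?K * \<rho> m * adj ?K
      = complex_of_real (sqrt (1 / p b)) \<cdot>\<^sub>m (complex_of_real (sqrt (1 / p b)) \<cdot>\<^sub>m ?X)"
      using Mb \<rho>m
      by (simp add: alg mult_smult_assoc_mat[of _ d d _ d] mult_smult_distrib[of _ d d _ d]
          del: real_sqrt_divide)
    also have "\<dots> = complex_of_real (sqrt (1 / p b) * sqrt (1 / p b)) \<cdot>\<^sub>m ?X"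
      using smult_smult by blast
    also have "\<dots> = \<rho>b b m" using b(2) unfolding rhob_m[OF b] by simp
    finally have "?K * \<rho> m * adj ?K = \<rho>b b m" .
    then have "psd (\<rho>b b m)" using psd_sandwich[OF \<rho>m K] by simp
    then show ?thesis using c tr1 by (simp add: density_def)
  qed
  let ?s = "\<lambda>b. \<Sum>n = m + 1..N. tr_ln (\<rho>b b n) (\<rho>ssb b n) - tr_ln (\<rho>b b (n - 1)) (\<rho>ssb b n)"
  have "vn_entropy (\<rho>b b m) - vn_entropy (\<rho>b b N) \<le> ?s b" if b: "b \<in> B" "p b > 0" for b
    using entropy_production_chain[of m N d "\<rho>b b" "Eb b" "\<rho>ssb b"]
      mN dens_b[OF b] Eb_cptp[OF b] Eb_ss[OF b] rhob_step[OF b] by auto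
  then have "(\<Sum>b\<in>{b\<in>B. p b > 0}. p b * (vn_entropy (\<rho>b b m) - vn_entropy (\<rho>b b N)))
    \<le> (\<Sum>b\<in>{b\<in>B. p b > 0}. p b * ?s b)"
    by (intro sum_mono mult_left_mono) auto
  \<comment> \<open>Adding the first-stage bound to the averaged second-stage bounds leaves
    S(\<open>\<rho> m\<close>) minus the averaged entropy after the measurement, which is
    \<open>I_QC\<close>.\<close>
  then show ?thesis
    using 1(2) unfolding I_QC_def sigma_def by (simp add: right_diff_distrib sum_subtractf)
qed

end
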